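(* Let $\alpha$ be a strictly positive finite measure on $\mathbb{R}$ with total mass $a>0$, let $\alpha_0=\alpha/a$, and let $n\ge1$ be a fixed integer. Let $\{M_m^{(n)},m\ge0\}$ be the Markov chain on $\mathbb{R}$ defined recursively by $$M_m^{(n)}=\theta_m\sum_{i=1}^n q_{m,i}^{(n)}\,Y_{m,i}+(1-\theta_m)\,M_{m-1}^{(n)},\qquad m\ge1,$$ with $M_0^{(n)}\in\mathbb{R}$ arbitrary. Then: (i) $\{M_m^{(n)},m\ge0\}$ is a stochastically monotone Markov chain; (ii) if further $$\mathbb{E}[|Y_{1,1}|]=\int_{\mathbb{R}}|x|\,\alpha_0(\mathrm{d}x)<+\infty,$$ then $\{M_m^{(n)},m\ge0\}$ is a geometrically ergodic Markov chain; (iii) if the support of $\alpha$ is bounded, then $\{M_m^{(n)},m\ge0\}$ is a uniformly ergodic Markov chain.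
   Context: $\{\theta_m,m\ge1\}$ is a sequence of independent random variables with Beta distribution with parameter $(n,a)$; $\{(q_{m,1}^{(n)},\ldots,q_{m,n}^{(n)}),m\ge1\}$ is a sequence of independent random vectors identically distributed according to the Dirichlet distribution with parameter $(1,\ldots,1)$ (so $\sum_{i=1}^n q_{m,i}^{(n)}=1$); $\{(Y_{m,1},\ldots,Y_{m,n}),m\ge1\}$ is a sequence of independent random vectors, each distributed as the first $n$ terms of a P\'olya sequence with parameter $\alpha$. These three sequences are mutually independent. A P\'olya sequence with parameter $\alpha$ is a sequence $\{Y_j,j\ge1\}$ of real random variables with $\mathbb{P}(Y_1\in A)=\alpha(A)/a$ and $\mathbb{P}(Y_{j+1}\in A\mid Y_1,\ldots,Y_j)=\frac{1}{a+j}\alpha(A)+\frac{1}{a+j}\sum_{i=1}^j\delta_{Y_i}(A)$ for $j\ge1$ and Borel $A\subseteq\mathbb{R}$. A Markov chain on $\mathbb{R}$ with one-step transition kernel $p_1(x,\cdot)$ is stochastically monotone if $p_1(z_1,(-\infty,s))\ge p_1(z_2,(-\infty,s))$ for all $z_1<z_2$ and $s\in\mathbb{R}$. Geometric and uniform ergodicity are understood in the usual sense of total variation convergence of the $m$-step transition probabilities to the invariant distribution, at a geometric rate, respectively uniformly in the starting point.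
   Formalization: In (ii), ergodicity on all of ℝ is claimed only if α is not a point mass (else only on its support's hull, where it is false off it); in (iii), uniformity is over the support's convex hull, or any compact interval containing the support if α is no point mass, since over ℝ it fails. *)

theory Defs
  imports "HOL-Probability.Probability"
begin

definition rvec :: "'i set \<Rightarrow> ('i \<Rightarrow> 'w \<Rightarrow> 'b) \<Rightarrow> 'w \<Rightarrow> 'i \<Rightarrow> 'b" where
  "rvec I X = (\<lambda>\<omega>. \<lambda>i\<in>I. X i \<omega>)"

definition generated_by :: "'w measure \<Rightarrow> ('w \<Rightarrow> 'b) \<Rightarrow> 'b measure \<Rightarrow> 'w measure" where
  "generated_by M X N = vimage_algebra (space M) X N"

text \<open>Mutual independence of three random elements whose value types may differ
  (\<^const>\<open>prob_space.indep_vars\<close> requires one common value type).\<close>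

definition indep_three ::
  "'w measure \<Rightarrow> 'b measure \<Rightarrow> ('w \<Rightarrow> 'b) \<Rightarrow> 'c measure \<Rightarrow> ('w \<Rightarrow> 'c) \<Rightarrow> 'd measure \<Rightarrow> ('w \<Rightarrow> 'd) \<Rightarrow> bool"
where
  "indep_three M N1 X1 N2 X2 N3 X3 \<longleftrightarrow>
     X1 \<in> M \<rightarrow>\<^sub>M N1 \<and> X2 \<in> M \<rightarrow>\<^sub>M N2 \<and> X3 \<in> M \<rightarrow>\<^sub>M N3 \<and>
     prob_space.indep_sets M
       (\<lambda>k. [sets (generated_by M X1 N1), sets (generated_by M X2 N2), sets (generated_by M X3 N3)] ! k)
       {..<3::nat}"

definition beta_density :: "real \<Rightarrow> real \<Rightarrow> real \<Rightarrow> real" where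
  "beta_density b c x =
     (if 0 < x \<and> x < 1 then x powr (b - 1) * (1 - x) powr (c - 1) / Beta b c else 0)"

definition gamma_density :: "real \<Rightarrow> real \<Rightarrow> real" where
  "gamma_density k x = (if 0 < x then x powr (k - 1) * exp (- x) / Gamma k else 0)"

text \<open>The Dirichlet distribution as the law of independent Gamma variables (of scale 1)
  normalised by their sum. This also covers an index set with one element, where the
  distribution is concentrated at 1.\<close>

definition dirichlet :: "'i set \<Rightarrow> ('i \<Rightarrow> real) \<Rightarrow> ('i \<Rightarrow> real) measure" where
  "dirichlet I \<gamma> =
     distr (PiM I (\<lambda>i. density lborel (\<lambda>x. ennreal (gamma_density (\<gamma> i) x))))
       (PiM I (\<lambda>_. borel)) (\<lambda>z. \<lambda>i\<in>I. z i / (\<Sum>j\<in>I. z j))"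

definition polya_sequence :: "real measure \<Rightarrow> 'p measure \<Rightarrow> (nat \<Rightarrow> 'p \<Rightarrow> real) \<Rightarrow> bool" where
  "polya_sequence \<alpha> N Z \<longleftrightarrow>
     prob_space N \<and>
     (\<forall>j\<ge>1. Z j \<in> N \<rightarrow>\<^sub>M borel) \<and>
     (\<forall>A\<in>sets borel. measure (distr N borel (Z 1)) A = measure \<alpha> A / measure \<alpha> UNIV) \<and>
     (\<forall>j\<ge>1. \<forall>A\<in>sets borel. AE \<omega> in N.
        real_cond_exp N (generated_by N (rvec {1..j} Z) (PiM {1..j} (\<lambda>_. borel)))
          (\<lambda>\<omega>. indicator A (Z (Suc j) \<omega>)) \<omega>
        = 1 / (measure \<alpha> UNIV + real j) * measure \<alpha> A
          + 1 / (measure \<alpha> UNIV + real j) * (\<Sum>i=1..j. indicator A (Z i \<omega>)))"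

definition msupport :: "'a::topological_space measure \<Rightarrow> 'a set" where
  "msupport \<mu> = {x. \<forall>U. open U \<longrightarrow> x \<in> U \<longrightarrow> 0 < emeasure \<mu> U}"

text \<open>Time-homogeneous Markov property with respect to the natural filtration.\<close>

definition markov_chain ::
  "'w measure \<Rightarrow> 's measure \<Rightarrow> ('s \<Rightarrow> 's measure) \<Rightarrow> (nat \<Rightarrow> 'w \<Rightarrow> 's) \<Rightarrow> bool"
where
  "markov_chain M S K X \<longleftrightarrow>
     K \<in> S \<rightarrow>\<^sub>M prob_algebra S \<and>
     (\<forall>m. X m \<in> M \<rightarrow>\<^sub>M S) \<and>
     (\<forall>m. \<forall>A\<in>sets S. AE \<omega> in M.
        real_cond_exp M (generated_by M (rvec {..m} X) (PiM {..m} (\<lambda>_. S)))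
          (\<lambda>\<omega>. indicator A (X (Suc m) \<omega>)) \<omega>
        = measure (K (X m \<omega>)) A)"

primrec kernel_pow :: "'s measure \<Rightarrow> ('s \<Rightarrow> 's measure) \<Rightarrow> nat \<Rightarrow> 's \<Rightarrow> 's measure" where
  "kernel_pow S K 0 x = return S x"
| "kernel_pow S K (Suc m) x = kernel_pow S K m x \<bind> K"

definition stochastically_monotone :: "(real \<Rightarrow> real measure) \<Rightarrow> bool" where
  "stochastically_monotone K \<longleftrightarrow>
     (\<forall>z1 z2 s. z1 < z2 \<longrightarrow> measure (K z1) {..<s} \<ge> measure (K z2) {..<s})"

definition tv_dist :: "'s measure \<Rightarrow> 's measure \<Rightarrow> real" where
  "tv_dist \<mu> \<nu> = (SUP A\<in>sets \<mu>. \<bar>measure \<mu> A - measure \<nu> A\<bar>)"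

definition invariant_distribution ::
  "'s measure \<Rightarrow> ('s \<Rightarrow> 's measure) \<Rightarrow> 's measure \<Rightarrow> bool"
where
  "invariant_distribution S K \<pi> \<longleftrightarrow> sets \<pi> = sets S \<and> prob_space \<pi> \<and> \<pi> \<bind> K = \<pi>"

text \<open>\<open>E\<close> can serve as the state space of a chain with kernel \<open>K\<close>: the chain never leaves it.\<close>

definition absorbing :: "'s measure \<Rightarrow> ('s \<Rightarrow> 's measure) \<Rightarrow> 's set \<Rightarrow> bool" where
  "absorbing S K E \<longleftrightarrow> E \<in> sets S \<and> (\<forall>x\<in>E. measure (K x) E = 1)"

text \<open>Ergodicity of the chain with state space \<open>E\<close>. In the geometric case the rate \<open>\<rho>\<close> does not
  depend on the starting point, the constant may.\<close>

definition geometrically_ergodic_on ::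
  "'s set \<Rightarrow> 's measure \<Rightarrow> ('s \<Rightarrow> 's measure) \<Rightarrow> bool"
where
  "geometrically_ergodic_on E S K \<longleftrightarrow>
     absorbing S K E \<and>
     (\<exists>\<pi>. invariant_distribution S K \<pi> \<and> measure \<pi> E = 1 \<and>
        (\<exists>\<rho> C. 0 < \<rho> \<and> \<rho> < 1 \<and>
           (\<forall>x\<in>E. \<forall>m. tv_dist (kernel_pow S K m x) \<pi> \<le> C x * \<rho> ^ m)))"

definition uniformly_ergodic_on ::
  "'s set \<Rightarrow> 's measure \<Rightarrow> ('s \<Rightarrow> 's measure) \<Rightarrow> bool"
where
  "uniformly_ergodic_on E S K \<longleftrightarrow>
     absorbing S K E \<and>
     (\<exists>\<pi>. invariant_distribution S K \<pi> \<and> measure \<pi> E = 1 \<and>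
        uniform_limit E (\<lambda>m x. tv_dist (kernel_pow S K m x) \<pi>) (\<lambda>_. 0) sequentially)"

text \<open>The chain started at \<open>x\<close>. The families \<open>\<theta>\<close>, \<open>q\<close> and \<open>Y\<close> are indexed by the time
  \<open>m \<ge> 1\<close> (the value at \<open>m = 0\<close> is never used), and then, for \<open>q\<close> and \<open>Y\<close>, by
  \<open>i \<in> {1..n}\<close>.\<close>

primrec mean_chain ::
  "nat \<Rightarrow> (nat \<Rightarrow> 'w \<Rightarrow> real) \<Rightarrow> (nat \<Rightarrow> nat \<Rightarrow> 'w \<Rightarrow> real) \<Rightarrow> (nat \<Rightarrow> nat \<Rightarrow> 'w \<Rightarrow> real) \<Rightarrow>
   real \<Rightarrow> nat \<Rightarrow> 'w \<Rightarrow> real"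
where
  "mean_chain n \<theta> q Y x 0 \<omega> = x"
| "mean_chain n \<theta> q Y x (Suc m) \<omega> =
     \<theta> (Suc m) \<omega> * (\<Sum>i=1..n. q (Suc m) i \<omega> * Y (Suc m) i \<omega>)
     + (1 - \<theta> (Suc m) \<omega>) * mean_chain n \<theta> q Y x m \<omega>"

definition mean_kernel ::
  "'w measure \<Rightarrow> nat \<Rightarrow> (nat \<Rightarrow> 'w \<Rightarrow> real) \<Rightarrow> (nat \<Rightarrow> nat \<Rightarrow> 'w \<Rightarrow> real) \<Rightarrow>
   (nat \<Rightarrow> nat \<Rightarrow> 'w \<Rightarrow> real) \<Rightarrow> real \<Rightarrow> real measure"
where
  "mean_kernel M n \<theta> q Y x = distr M borel (mean_chain n \<theta> q Y x 1)"

text \<open>Two remarks on state spaces.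

  If \<open>\<alpha>\<close> is carried by a single point \<open>c\<close>, the invariant distribution is the point mass at
  \<open>c\<close>, and the chain started at \<open>x \<noteq> c\<close> stays at total variation distance 1 from it for
  ever. Such \<open>\<alpha>\<close> have to be excluded from ergodicity statements about chains started at
  points outside the convex hull of the support, here \<open>{c}\<close>.

  If the support is bounded, the convergence cannot be uniform over all starting points in the
  real line: for fixed \<open>m\<close>, as \<open>x\<close> tends to infinity, the chain started at \<open>x\<close> is
  at time \<open>m\<close> above the support with probability tending to 1. Uniform ergodicity refers to
  bounded state spaces: the convex hull of the support or, more generally, compact intervals
  containing the support. Every real starting point lies in such an interval.\<close>

definition point_supported :: "real measure \<Rightarrow> bool" where
  "point_supported \<alpha> \<longleftrightarrow> (\<exists>c. AE x in \<alpha>. x = c)"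

end

theory Submission
  imports Defs
begin

text \<open>
  Ergodicity follows from Harris' theorem in the form of Hairer and Mattingly. Write \<open>V\<close> for the
  weighted sum of the \<open>Y\<close>, so that a step is \<open>x \<mapsto> \<theta> V + (1 - \<theta>) x\<close>. Since \<open>0 < \<theta> < 1\<close>, the
  function \<open>\<bar>x\<bar>\<close> satisfies the drift inequality \<open>E \<bar>\<theta> V + (1 - \<theta>) x\<bar> \<le> g \<bar>x\<bar> + D\<close> with
  \<open>g = E (1 - \<theta>) < 1\<close> and \<open>D = E \<bar>V\<bar> \<le> n \<integral> \<bar>x\<bar> d\<alpha>0\<close>. If \<open>\<alpha>\<close> is not carried by a point, then
  \<open>V\<close> charges neighbourhoods of two distinct points, and the Beta density spreads a step
  over the gap between them, so the kernels at two bounded starting points overlap by a fixed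
  amount. Drift and overlap contract the oscillation of functions, measured against
  \<open>2 + \<beta> \<bar>x\<bar> + \<beta> \<bar>y\<bar>\<close> for small \<open>\<beta>\<close>. Hence the \<open>m\<close>-step kernels converge, at distance at most
  \<open>C (1 + \<bar>x\<bar>) \<rho>\<^sup>m\<close>, and this bound is uniform on bounded state spaces.
\<close>

section \<open>Convergence of kernels in total variation\<close>

text \<open>The usual form of Harris' theorem asks for one minorant valid on a whole sublevel set.
  That does not fit this chain: from x the step has no lower density bound near x itself, since the
  Beta density vanishes at 0 when n is at least 2, and over a long interval of starting points the
  lost neighbourhoods would cover the entire gap. Two starting points lose only two short windows.
  The contraction is applied to the functions that send x to the m-step probability of a set A, with
  constants that do not depend on A. This uniformity is what produces a limit set function, its
  countable additivity and its invariance, so the invariant distribution is constructed along the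
  way and no formula for it is needed. The overlap rests on two facts about V: it lies in every
  convex set that contains all the Y, and all n terms of a Polya sequence fall into a given set of
  positive \<alpha> mass with positive probability. If \<alpha> is carried by a point, the hull of
  the support is a single absorbing point, which is treated separately.\<close>

lemma nn_integral_mono_measure:
  assumes sets: "sets \<eta> = sets \<mu>"
    and le: "\<And>A. A \<in> sets \<mu> \<Longrightarrow> emeasure \<eta> A \<le> emeasure \<mu> A"
  shows "(\<integral>\<^sup>+x. f x \<partial>\<eta>) \<le> (\<integral>\<^sup>+x. f x \<partial>\<mu>)"
proof -
  have sp: "space \<eta> = space \<mu>"
    using sets by (rule sets_eq_imp_space_eq)
  have sf: "simple_function \<eta> g \<longleftrightarrow> simple_function \<mu> g" for g :: "_ \<Rightarrow> ennreal"
    using sets sp by (simp add: simple_function_def)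
  have "simple_integral \<eta> g \<le> simple_integral \<mu> g" if g: "simple_function \<mu> g" for g
    unfolding simple_integral_def sp
    by (intro sum_mono mult_left_mono le simple_functionD(2)[OF g]) simp
  then show ?thesis
    unfolding nn_integral_def sf by (intro SUP_mono) auto
qed

text \<open>A function with values in [0, 1] is, up to 1/N, the average of N indicators of its
  superlevel sets. Each indicator contributes at most e/N, so the bound for sets carries over with
  the same constant.\<close>

lemma abs_integral_diff_le_of_measure_diff_le:
  assumes \<mu>: "prob_space \<mu>" and \<nu>: "prob_space \<nu>" and sets: "sets \<nu> = sets \<mu>"
    and le: "\<And>A. A \<in> sets \<mu> \<Longrightarrow> \<bar>measure \<mu> A - measure \<nu> A\<bar> \<le> e"
    and f[measurable]: "f \<in> borel_measurable \<mu>"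
    and f01: "\<And>x. x \<in> space \<mu> \<Longrightarrow> 0 \<le> f x \<and> f x \<le> (1::real)"
  shows "\<bar>(\<integral>x. f x \<partial>\<mu>) - (\<integral>x. f x \<partial>\<nu>)\<bar> \<le> e"
proof -
  interpret \<mu>: prob_space \<mu> by fact
  interpret \<nu>: prob_space \<nu> by fact
  have sp: "space \<nu> = space \<mu>"
    using sets by (rule sets_eq_imp_space_eq)
  have f'[measurable]: "f \<in> borel_measurable \<nu>"
    using f measurable_cong_sets[OF sets refl] by blast
  have bound: "\<bar>(\<integral>x. f x \<partial>\<mu>) - (\<integral>x. f x \<partial>\<nu>)\<bar> \<le> e + 2 / real N" if N: "N > 0" for N :: nat
  proof -
    \<comment> \<open>\<open>g\<close> is f rounded down to a multiple of 1/N: it counts the k with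
      k/N at most f x.\<close>
    define g where "g x = (\<Sum>k=1..N. indicator {x \<in> space \<mu>. real k / N \<le> f x} x / N :: real)" for x
    have g: "g x \<le> f x \<and> f x \<le> g x + 1 / N" if x: "x \<in> space \<mu>" for x
    proof -
      define j where "j = nat \<lfloor>N * f x\<rfloor>"
      have fx: "0 \<le> f x" "f x \<le> 1" using f01[OF x] by auto
      have Nf: "0 \<le> N * f x" "N * f x \<le> N" using fx N by (auto simp: mult_left_le)
      have j1: "real j \<le> N * f x" "N * f x < real j + 1"
        using Nf unfolding j_def by linarith+
      have j2: "j \<le> N" using j1 Nf by linarith
      have "real k / N \<le> f x \<longleftrightarrow> k \<le> j" for k :: nat
      proof -
        have "real k / N \<le> f x \<longleftrightarrow> real k \<le> N * f x" using N by (simp add: field_simps)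
        also have "\<dots> \<longleftrightarrow> k \<le> j" using j1 by linarith
        finally show ?thesis .
      qed
      then have "g x = (\<Sum>k=1..N. (if k \<in> {1..j} then 1 / N else 0))"
        unfolding g_def using x by (intro sum.cong) (auto simp: indicator_def)
      also have "\<dots> = (\<Sum>k\<in>{1..j}. 1 / N)"
        using j2 by (subst sum.inter_restrict[symmetric]) (auto intro!: sum.cong)
      finally have "g x = real j / N" by simp
      moreover have "real j / N \<le> f x" "f x \<le> real j / N + 1 / N"
        using j1 N by (simp_all add: field_simps)
      ultimately show ?thesis by simp
    qed
    have [measurable]: "{x \<in> space \<mu>. real k / N \<le> f x} \<in> sets \<mu>" for k by measurable
    have [measurable]: "{x \<in> space \<mu>. real k / N \<le> f x} \<in> sets \<nu>" for k using sets by simp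
    have g\<mu>: "integrable \<mu> g" "(\<integral>x. g x \<partial>\<mu>) = (\<Sum>k=1..N. measure \<mu> {x \<in> space \<mu>. real k / N \<le> f x} / N)"
      unfolding g_def by (auto simp: \<mu>.emeasure_eq_measure intro!: integrable_real_indicator Bochner_Integration.integrable_sum Bochner_Integration.integrable_divide)
    have g\<nu>: "integrable \<nu> g" "(\<integral>x. g x \<partial>\<nu>) = (\<Sum>k=1..N. measure \<nu> {x \<in> space \<mu>. real k / N \<le> f x} / N)"
      unfolding g_def by (auto simp: \<nu>.emeasure_eq_measure intro!: integrable_real_indicator Bochner_Integration.integrable_sum Bochner_Integration.integrable_divide)
    have f\<mu>: "integrable \<mu> f" by (rule \<mu>.integrable_const_bound[where B=1]) (auto intro!: AE_I2 simp: f01)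
    have f\<nu>: "integrable \<nu> f" by (rule \<nu>.integrable_const_bound[where B=1]) (auto intro!: AE_I2 simp: f01 sp)
    have 1: "(\<integral>x. g x \<partial>\<mu>) \<le> (\<integral>x. f x \<partial>\<mu>)" "(\<integral>x. f x \<partial>\<mu>) \<le> (\<integral>x. g x + 1 / N \<partial>\<mu>)"
      using g g\<mu>(1) f\<mu> by - (rule integral_mono; simp)+
    have 2: "(\<integral>x. g x \<partial>\<nu>) \<le> (\<integral>x. f x \<partial>\<nu>)" "(\<integral>x. f x \<partial>\<nu>) \<le> (\<integral>x. g x + 1 / N \<partial>\<nu>)"
      using g g\<nu>(1) f\<nu> by - (rule integral_mono; simp add: sp)+
    have 3: "(\<integral>x. g x + 1 / N \<partial>\<mu>) = (\<integral>x. g x \<partial>\<mu>) + 1 / N" "(\<integral>x. g x + 1 / N \<partial>\<nu>) = (\<integral>x. g x \<partial>\<nu>) + 1 / N"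
      using g\<mu> g\<nu> by (auto simp: \<mu>.prob_space \<nu>.prob_space)
    have "\<bar>(\<integral>x. g x \<partial>\<mu>) - (\<integral>x. g x \<partial>\<nu>)\<bar> =
      \<bar>\<Sum>k=1..N. (measure \<mu> {x \<in> space \<mu>. real k / N \<le> f x} - measure \<nu> {x \<in> space \<mu>. real k / N \<le> f x}) / N\<bar>"
      unfolding g\<mu> g\<nu> by (simp add: sum_subtractf diff_divide_distrib)
    also have "\<dots> \<le> (\<Sum>k=1..N. e / N)"
      using N by (intro order_trans[OF sum_abs] sum_mono) (auto intro!: divide_right_mono le)
    also have "\<dots> = e" using N by simp
    finally show ?thesis using 1 2 3 by (simp add: abs_le_iff)
  qed
  have "(\<lambda>N. e + 2 / real N) \<longlonglongrightarrow> e + 0"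
    by (intro tendsto_intros tendsto_divide_0[OF tendsto_const] filterlim_real_sequentially
      filterlim_at_top_imp_at_infinity)
  then show ?thesis
    by (intro LIMSEQ_le_const[where X="\<lambda>N. e + 2 / real N"]) (auto intro!: exI[of _ 1] bound)
qed

text \<open>Completeness of the probability measures in total variation. Since \<open>c m\<close>
  does not depend on A, one fixed \<open>\<mu> m\<close> approximates p on a countable union and on
  all its partial unions at once; this lifts the finite additivity of p to countable
  additivity.\<close>

lemma prob_space_uniform_limit_exists:
  assumes \<mu>: "\<And>m. prob_space (\<mu> m)" "\<And>m. sets (\<mu> m) = sets S"
    and le: "\<And>m A. A \<in> sets S \<Longrightarrow> \<bar>measure (\<mu> m) A - p A\<bar> \<le> c m"
    and c: "c \<longlonglongrightarrow> (0::real)"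
  shows "\<exists>\<pi>. prob_space \<pi> \<and> sets \<pi> = sets S \<and> (\<forall>A\<in>sets S. measure \<pi> A = p A)"
proof -
  interpret \<mu>: prob_space "\<mu> m" for m by fact
  have sp: "space (\<mu> m) = space S" for m
    using \<mu>(2) by (rule sets_eq_imp_space_eq)
  have lim: "(\<lambda>m. measure (\<mu> m) A) \<longlonglongrightarrow> p A" if "A \<in> sets S" for A
    by (rule metric_tendsto_imp_tendsto[OF c]) (use le[OF that] in \<open>auto simp: dist_real_def intro!: always_eventually order_trans[OF _ abs_ge_self]\<close>)
  have p0: "0 \<le> p A" if "A \<in> sets S" for A
    by (rule LIMSEQ_le_const[OF lim[OF that]]) auto
  have p1: "p (space S) = 1"
    by (rule LIMSEQ_unique[OF lim]) (use \<mu>.prob_space in \<open>auto simp: sp\<close>)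
  have pempty: "p {} = 0"
    by (rule LIMSEQ_unique[OF lim]) auto
  have psum: "p (\<Union>i<k. A i) = (\<Sum>i<k. p (A i))"
    if "range A \<subseteq> sets S" "disjoint_family A" for A :: "nat \<Rightarrow> _" and k
  proof (rule LIMSEQ_unique[OF lim])
    show "(\<Union>i<k. A i) \<in> sets S" using that by auto
    have "measure (\<mu> m) (\<Union>i<k. A i) = (\<Sum>i<k. measure (\<mu> m) (A i))" for m
      using that \<mu>(2) by (intro \<mu>.finite_measure_finite_Union) (auto simp: disjoint_family_on_def)
    then show "(\<lambda>m. measure (\<mu> m) (\<Union>i<k. A i)) \<longlonglongrightarrow> (\<Sum>i<k. p (A i))"
      using that by (auto intro!: tendsto_sum lim)
  qed
  have sums: "(\<lambda>i. p (A i)) sums p (\<Union>i. A i)"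
    if A: "range A \<subseteq> sets S" "disjoint_family A" for A :: "nat \<Rightarrow> _"
    unfolding sums_def
  proof (rule LIMSEQ_I)
    fix e :: real assume e: "0 < e"
    \<comment> \<open>Three errors add up: passing from p to \<open>\<mu> m\<close> on the partial
      union, the same on the full union, and the tail of the series for \<open>\<mu> m\<close>. Each
      is at most e/4.\<close>
    from order_tendstoD(2)[OF c, of "e / 4"] e obtain m where m: "c m < e / 4"
      by (auto simp: eventually_sequentially)
    have "(\<lambda>i. measure (\<mu> m) (A i)) sums measure (\<mu> m) (\<Union>i. A i)"
      using A \<mu>(2) by (intro \<mu>.finite_measure_UNION) auto
    then obtain n0 where n0: "\<And>n. n \<ge> n0 \<Longrightarrow>
        \<bar>(\<Sum>i<n. measure (\<mu> m) (A i)) - measure (\<mu> m) (\<Union>i. A i)\<bar> < e / 4"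
      using e unfolding sums_def by (metis LIMSEQ_D[where r="e/4"] real_norm_def zero_less_divide_iff zero_less_numeral)
    show "\<exists>n0. \<forall>n\<ge>n0. norm ((\<Sum>i<n. p (A i)) - p (\<Union>i. A i)) < e"
    proof (intro exI allI impI)
      fix n assume n: "n \<ge> n0"
      have "measure (\<mu> m) (\<Union>i<n. A i) = (\<Sum>i<n. measure (\<mu> m) (A i))"
        using A \<mu>(2) by (intro \<mu>.finite_measure_finite_Union) (auto simp: disjoint_family_on_def)
      moreover have "\<bar>measure (\<mu> m) (\<Union>i<n. A i) - p (\<Union>i<n. A i)\<bar> \<le> c m"
        using A by (intro le) auto
      moreover have "\<bar>measure (\<mu> m) (\<Union>i. A i) - p (\<Union>i. A i)\<bar> \<le> c m"
        using A by (intro le) auto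
      ultimately show "norm ((\<Sum>i<n. p (A i)) - p (\<Union>i. A i)) < e"
        using n0[OF n] m psum[OF A, of n] unfolding real_norm_def by linarith
    qed
  qed
  define \<pi> where "\<pi> = measure_of (space S) (sets S) (\<lambda>A. ennreal (p A))"
  have sets\<pi>: "sets \<pi> = sets S" unfolding \<pi>_def by (simp add: sets.space_closed)
  have em: "emeasure \<pi> A = ennreal (p A)" if "A \<in> sets S" for A
    unfolding \<pi>_def
  proof (rule emeasure_measure_of_sigma)
    show "sigma_algebra (space S) (sets S)" ..
    show "positive (sets S) (\<lambda>A. ennreal (p A))" by (simp add: positive_def pempty)
    show "countably_additive (sets S) (\<lambda>A. ennreal (p A))"
    proof (rule countably_additiveI)
      fix A :: "nat \<Rightarrow> _" assume A: "range A \<subseteq> sets S" "disjoint_family A"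
      show "(\<Sum>i. ennreal (p (A i))) = ennreal (p (\<Union>i. A i))"
        using sums[OF A] A by (intro suminf_ennreal_eq p0) auto
    qed
  qed fact
  have "prob_space \<pi>"
    by (rule prob_spaceI) (simp add: em sets_eq_imp_space_eq[OF sets\<pi>] p1)
  then show ?thesis
    using sets\<pi> em p0 by (intro exI[of _ \<pi>]) (auto simp: measure_def)
qed

section \<open>Powers of a Markov kernel\<close>

locale markov_kernel =
  fixes S :: "'s measure" and K :: "'s \<Rightarrow> 's measure"
  assumes K[measurable]: "K \<in> S \<rightarrow>\<^sub>M prob_algebra S"
begin

lemma prob_space_K: "x \<in> space S \<Longrightarrow> prob_space (K x)"
  and sets_K: "x \<in> space S \<Longrightarrow> sets (K x) = sets S"
  using measurable_space[OF K] by (auto simp: space_prob_algebra)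

lemma space_K: "x \<in> space S \<Longrightarrow> space (K x) = space S"
  using sets_K by (rule sets_eq_imp_space_eq)

lemma measurable_kernel_pow[measurable]: "kernel_pow S K m \<in> S \<rightarrow>\<^sub>M prob_algebra S"
proof (induction m)
  case (Suc m)
  show ?case
    unfolding kernel_pow.simps using Suc K by (rule measurable_bind_prob_space)
qed (simp, measurable)

lemma prob_space_kernel_pow: "x \<in> space S \<Longrightarrow> prob_space (kernel_pow S K m x)"
  and sets_kernel_pow: "x \<in> space S \<Longrightarrow> sets (kernel_pow S K m x) = sets S"
  using measurable_space[OF measurable_kernel_pow] by (auto simp: space_prob_algebra)

lemma space_kernel_pow: "x \<in> space S \<Longrightarrow> space (kernel_pow S K m x) = space S"
  using sets_kernel_pow by (rule sets_eq_imp_space_eq)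

text \<open>\<open>kernel_pow\<close> appends its steps at the end, whereas the contraction argument
  splits off the first step. Associativity of \<open>bind\<close> reconciles the two.\<close>

lemma kernel_pow_Suc_left:
  "x \<in> space S \<Longrightarrow> kernel_pow S K (Suc m) x = K x \<bind> kernel_pow S K m"
proof (induction m)
  case 0
  have "kernel_pow S K (Suc 0) x = K x"
    using 0 by (simp add: bind_return[OF measurable_prob_algebraD[OF K]])
  also have "\<dots> = K x \<bind> return S"
    using 0 by (simp add: bind_return''[OF sets_K])
  finally show ?case by (simp add: kernel_pow.simps(1)[abs_def])
next
  case (Suc m)
  have "kernel_pow S K (Suc (Suc m)) x = (K x \<bind> kernel_pow S K m) \<bind> K"
    unfolding kernel_pow.simps(2)[of S K "Suc m"] using Suc by simp
  also have "\<dots> = K x \<bind> (\<lambda>y. kernel_pow S K m y \<bind> K)"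
  proof (rule bind_assoc)
    have "kernel_pow S K m \<in> S \<rightarrow>\<^sub>M subprob_algebra S"
      by (intro measurable_prob_algebraD measurable_kernel_pow)
    then show "kernel_pow S K m \<in> K x \<rightarrow>\<^sub>M subprob_algebra S"
      using measurable_cong_sets[OF sets_K[OF Suc.prems] refl] by blast
  qed (rule measurable_prob_algebraD[OF K])
  finally show ?case by simp
qed

text \<open>Splitting off the first step serves the contraction, splitting off the last one serves
  the invariance of the limit.\<close>

lemma measure_kernel_pow_Suc:
  assumes "x \<in> space S" "A \<in> sets S"
  shows "measure (kernel_pow S K (Suc m) x) A = (\<integral>y. measure (kernel_pow S K m y) A \<partial>K x)"
    and "measure (kernel_pow S K (Suc m) x) A = (\<integral>y. measure (K y) A \<partial>kernel_pow S K m x)"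
proof -
  interpret K: prob_space "K x" using assms by (intro prob_space_K)
  interpret Km: prob_space "kernel_pow S K m x" using assms by (intro prob_space_kernel_pow)
  have "kernel_pow S K m \<in> K x \<rightarrow>\<^sub>M subprob_algebra S"
    using measurable_prob_algebraD[OF measurable_kernel_pow] measurable_cong_sets[OF sets_K[OF assms(1)] refl] by blast
  then show "measure (kernel_pow S K (Suc m) x) A = (\<integral>y. measure (kernel_pow S K m y) A \<partial>K x)"
    using assms by (simp only: kernel_pow_Suc_left K.measure_bind)
  have "K \<in> kernel_pow S K m x \<rightarrow>\<^sub>M subprob_algebra S"
    using measurable_prob_algebraD[OF K] measurable_cong_sets[OF sets_kernel_pow[OF assms(1)] refl] by blast
  then show "measure (kernel_pow S K (Suc m) x) A = (\<integral>y. measure (K y) A \<partial>kernel_pow S K m x)"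
    using assms by (simp add: Km.measure_bind)
qed

end

section \<open>Harris' theorem\<close>

text \<open>Minorisation is only required for pairs of points, each pair with its own minorant; this
  is all that the argument of Hairer and Mattingly for Harris' theorem uses.\<close>

locale harris_kernel = markov_kernel +
  fixes L :: "'s \<Rightarrow> real" and g D :: real
  assumes L[measurable]: "L \<in> borel_measurable S"
    and L_nonneg: "\<And>x. x \<in> space S \<Longrightarrow> 0 \<le> L x"
    and g: "0 \<le> g" "g < 1" and D: "0 \<le> D"
    and drift: "\<And>x. x \<in> space S \<Longrightarrow> (\<integral>\<^sup>+y. ennreal (L y) \<partial>K x) \<le> ennreal (g * L x + D)"
    and minor: "\<And>R. \<exists>e>0. \<forall>x\<in>space S. \<forall>y\<in>space S. L x \<le> R \<longrightarrow> L y \<le> R \<longrightarrow>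
      (\<exists>\<eta>. sets \<eta> = sets S \<and> ennreal e \<le> emeasure \<eta> (space S) \<and>
        (\<forall>A\<in>sets S. emeasure \<eta> A \<le> emeasure (K x) A \<and> emeasure \<eta> A \<le> emeasure (K y) A))"
begin

lemma borel_measurable_K: "x \<in> space S \<Longrightarrow> f \<in> borel_measurable S \<Longrightarrow> f \<in> borel_measurable (K x)"
  using measurable_cong_sets[OF sets_K refl] by blast

lemma integrable_L: "integrable (K x) L"
  and integral_L_le: "(\<integral>y. L y \<partial>K x) \<le> g * L x + D" if x: "x \<in> space S"
proof -
  have [measurable]: "L \<in> borel_measurable (K x)" by (rule borel_measurable_K[OF x L])
  have pos: "AE y in K x. 0 \<le> L y" by (rule AE_I2) (simp add: space_K[OF x] L_nonneg)
  have "(\<integral>\<^sup>+y. ennreal (norm (L y)) \<partial>K x) = (\<integral>\<^sup>+y. ennreal (L y) \<partial>K x)"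
    by (intro nn_integral_cong) (simp add: space_K[OF x] L_nonneg)
  also have "\<dots> < \<infinity>" using drift[OF x] by (rule le_less_trans) simp
  finally show *: "integrable (K x) L" by (intro integrableI_bounded) auto
  have "ennreal (\<integral>y. L y \<partial>K x) \<le> ennreal (g * L x + D)"
    using drift[OF x] by (subst nn_integral_eq_integral[OF * pos, symmetric])
  then show "(\<integral>y. L y \<partial>K x) \<le> g * L x + D"
    by (rule ennreal_le_iff[THEN iffD1, rotated]) (use g D L_nonneg[OF x] in auto)
qed

text \<open>The functions w - \<psi> and w + \<psi> are nonnegative, so their integrals under
  \<open>K x\<close> and \<open>K y\<close> dominate those under the common minorant \<eta>. There
  they add up to 2 w, which is at least 2 s, on a mass of at least e. This is the gain over the
  trivial bound by the two integrals of w.\<close>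

lemma overlap_integral_le:
  assumes x: "x \<in> space S" and y: "y \<in> space S"
    and \<eta>: "sets \<eta> = sets S" "ennreal e \<le> emeasure \<eta> (space S)"
      "\<And>A. A \<in> sets S \<Longrightarrow> emeasure \<eta> A \<le> emeasure (K x) A"
      "\<And>A. A \<in> sets S \<Longrightarrow> emeasure \<eta> A \<le> emeasure (K y) A"
    and e: "0 \<le> e" "0 \<le> s"
    and [measurable]: "w \<in> borel_measurable S" "\<psi> \<in> borel_measurable S"
    and w: "\<And>z. z \<in> space S \<Longrightarrow> \<bar>\<psi> z\<bar> \<le> w z" "\<And>z. z \<in> space S \<Longrightarrow> s \<le> w z"
    and int: "integrable (K x) w" "integrable (K y) w" "integrable (K x) \<psi>" "integrable (K y) \<psi>"
  shows "(\<integral>z. \<psi> z \<partial>K x) - (\<integral>z. \<psi> z \<partial>K y) \<le> (\<integral>z. w z \<partial>K x) + (\<integral>z. w z \<partial>K y) - 2 * s * e"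
proof -
  have sp: "space \<eta> = space S" using \<eta>(1) by (rule sets_eq_imp_space_eq)
  have [measurable]: "w \<in> borel_measurable \<eta>" "\<psi> \<in> borel_measurable \<eta>"
    using measurable_cong_sets[OF \<eta>(1) refl] by (blast intro: assms)+
  have nn: "0 \<le> w z - \<psi> z" "0 \<le> w z + \<psi> z" "0 \<le> w z" if "z \<in> space S" for z
    using w(1)[OF that] by auto
  have ge: "(\<integral>\<^sup>+z. f z \<partial>\<eta>) \<le> (\<integral>\<^sup>+z. f z \<partial>K x)" "(\<integral>\<^sup>+z. f z \<partial>\<eta>) \<le> (\<integral>\<^sup>+z. f z \<partial>K y)" for f
    using \<eta> x y sets_K by (auto intro!: nn_integral_mono_measure)
  have "ennreal (2 * s * e) \<le> ennreal (2 * s) * emeasure \<eta> (space \<eta>)"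
    using \<eta>(2) e by (simp add: sp ennreal_mult mult_left_mono)
  also have "\<dots> = (\<integral>\<^sup>+z. ennreal (2 * s) \<partial>\<eta>)" by simp
  also have "\<dots> \<le> (\<integral>\<^sup>+z. ennreal (w z - \<psi> z) + ennreal (w z + \<psi> z) \<partial>\<eta>)"
  proof (rule nn_integral_mono)
    fix z assume "z \<in> space \<eta>"
    then show "ennreal (2 * s) \<le> ennreal (w z - \<psi> z) + ennreal (w z + \<psi> z)"
      using nn w(2) by (simp add: sp ennreal_plus[symmetric] ennreal_leI del: ennreal_plus)
  qed
  also have "\<dots> = (\<integral>\<^sup>+z. ennreal (w z - \<psi> z) \<partial>\<eta>) + (\<integral>\<^sup>+z. ennreal (w z + \<psi> z) \<partial>\<eta>)"
    by (rule nn_integral_add) auto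
  also have "\<dots> \<le> (\<integral>\<^sup>+z. ennreal (w z - \<psi> z) \<partial>K x) + (\<integral>\<^sup>+z. ennreal (w z + \<psi> z) \<partial>K y)"
    by (intro add_mono ge)
  also have "(\<integral>\<^sup>+z. ennreal (w z - \<psi> z) \<partial>K x) = ennreal (\<integral>z. w z - \<psi> z \<partial>K x)"
    using int nn by (intro nn_integral_eq_integral) (auto intro!: AE_I2 simp: space_K[OF x])
  also have "(\<integral>\<^sup>+z. ennreal (w z + \<psi> z) \<partial>K y) = ennreal (\<integral>z. w z + \<psi> z \<partial>K y)"
    using int nn by (intro nn_integral_eq_integral) (auto intro!: AE_I2 simp: space_K[OF y])
  finally have "ennreal (2 * s * e) \<le> ennreal (\<integral>z. w z - \<psi> z \<partial>K x) + ennreal (\<integral>z. w z + \<psi> z \<partial>K y)" .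
  moreover have "0 \<le> (\<integral>z. w z - \<psi> z \<partial>K x)" "0 \<le> (\<integral>z. w z + \<psi> z \<partial>K y)"
    using nn by (auto intro!: integral_nonneg_AE AE_I2 simp: space_K[OF x] space_K[OF y] simp del: integral_diff integral_add)
  ultimately have "2 * s * e \<le> (\<integral>z. w z - \<psi> z \<partial>K x) + (\<integral>z. w z + \<psi> z \<partial>K y)"
    by (simp add: ennreal_plus[symmetric] del: ennreal_plus)
  then show ?thesis using int by simp
qed

text \<open>The size of L x + L y decides which mechanism contracts. If it is large, the drift alone
  shrinks the weight 2 + \<beta> L x + \<beta> L y by a fixed factor. Otherwise both points lie
  where the kernels overlap, and the overlap takes 2 e off the constant 2, more than the drift
  constant can add back when \<beta> is small.\<close>

lemma weighted_oscillation_contraction: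
  "\<exists>\<rho> \<beta>. 0 < \<rho> \<and> \<rho> < 1 \<and> 0 < \<beta> \<and>
    (\<forall>f\<in>borel_measurable S. \<forall>s\<ge>0. (\<forall>x\<in>space S. \<bar>f x\<bar> \<le> 1) \<longrightarrow>
      (\<forall>x\<in>space S. \<forall>y\<in>space S. \<bar>f x - f y\<bar> \<le> s * (2 + \<beta> * L x + \<beta> * L y)) \<longrightarrow>
      (\<forall>x\<in>space S. \<forall>y\<in>space S. \<bar>(\<integral>z. f z \<partial>K x) - (\<integral>z. f z \<partial>K y)\<bar> \<le> \<rho> * s * (2 + \<beta> * L x + \<beta> * L y)))"
proof -
  \<comment> \<open>With g' - g = (1 - g) / 2 this gives (g' - g) * R at least 2 * D, the drift
    constants of both points together. The summand 1 keeps \<open>R\<close> positive when D =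
    0.\<close>
  define R where "R = 4 * D / (1 - g) + 1"
  obtain e where e: "0 < e" and ov: "\<And>x y. x \<in> space S \<Longrightarrow> y \<in> space S \<Longrightarrow> L x \<le> R \<Longrightarrow> L y \<le> R \<Longrightarrow>
      (\<exists>\<eta>. sets \<eta> = sets S \<and> ennreal e \<le> emeasure \<eta> (space S) \<and>
        (\<forall>A\<in>sets S. emeasure \<eta> A \<le> emeasure (K x) A \<and> emeasure \<eta> A \<le> emeasure (K y) A))"
    using minor[of R] by blast
  \<comment> \<open>Small enough that the drift adds 2 * \<beta> * D, at most e, which leaves a net
    gain of e from the 2 * e of the overlap. The + 1 avoids division by zero.\<close>
  define \<beta> where "\<beta> = e / (2 * (D + 1))"
  define g' where "g' = (1 + g) / 2"
  \<comment> \<open>The first two entries handle close pairs, for the constant and the \<beta> part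
    of the weight. The quotient is the ratio attained at L x + L y = R; beyond \<open>R\<close>
    every further unit contracts at rate g'.\<close>
  define \<rho> where "\<rho> = max (max (1 - e / 2) g') ((2 + \<beta> * R * g') / (2 + \<beta> * R))"
  have R: "0 < R" using D g by (simp add: R_def add_nonneg_pos)
  have \<beta>: "0 < \<beta>" using e D by (simp add: \<beta>_def)
  have \<beta>D: "2 * \<beta> * D \<le> e"
    using e D by (simp add: \<beta>_def field_simps)
  have g': "0 < g'" "g' < 1" "g \<le> g'" using g by (auto simp: g'_def)
  have RD: "2 * D \<le> (g' - g) * r" if "R \<le> r" for r
  proof -
    have "(1 - g) / 2 * R = 2 * D + (1 - g) / 2" using g by (simp add: R_def distrib_left)
    then have "2 * D \<le> (1 - g) / 2 * R" using g by simp
    also have "\<dots> \<le> (1 - g) / 2 * r" using that g by (intro mult_left_mono) auto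
    finally show ?thesis by (simp add: g'_def field_simps)
  qed
  have \<beta>R: "0 < \<beta> * R" using \<beta> R by simp
  have \<rho>: "0 < \<rho>" "\<rho> < 1" "1 - e / 2 \<le> \<rho>" "g' \<le> \<rho>" "2 + \<beta> * R * g' \<le> \<rho> * (2 + \<beta> * R)"
  proof -
    have "(2 + \<beta> * R * g') / (2 + \<beta> * R) < 1"
      using \<beta>R g' by (simp add: mult_less_cancel_left2)
    then show "\<rho> < 1" using e g' by (simp add: \<rho>_def)
    have "(2 + \<beta> * R * g') / (2 + \<beta> * R) \<le> \<rho>" by (simp add: \<rho>_def)
    then show "2 + \<beta> * R * g' \<le> \<rho> * (2 + \<beta> * R)" using \<beta>R by (simp add: field_simps)
  qed (use g' in \<open>auto simp: \<rho>_def less_max_iff_disj\<close>)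
  have far: "2 + \<beta> * (g * r + 2 * D) \<le> \<rho> * (2 + \<beta> * r)" if r: "R \<le> r" for r
  proof -
    have "2 + \<beta> * (g * r + 2 * D) \<le> 2 + \<beta> * (g' * r)"
      using RD[OF r] \<beta> by (intro add_left_mono mult_left_mono) (auto simp: algebra_simps)
    also have "\<dots> = (2 + \<beta> * R * g') + g' * (\<beta> * (r - R))" by (simp add: algebra_simps)
    also have "\<dots> \<le> \<rho> * (2 + \<beta> * R) + \<rho> * (\<beta> * (r - R))"
      using \<rho> \<beta> r by (intro add_mono mult_right_mono) auto
    finally show ?thesis by (simp add: algebra_simps)
  qed
  have near: "2 - 2 * e + \<beta> * (g * r + 2 * D) \<le> \<rho> * (2 + \<beta> * r)" if r: "0 \<le> r" for r
  proof -
    have "2 - 2 * e + \<beta> * (g * r + 2 * D) \<le> (1 - e / 2) * 2 + g * (\<beta> * r)"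
      using \<beta>D by (simp add: algebra_simps)
    also have "\<dots> \<le> \<rho> * 2 + \<rho> * (\<beta> * r)"
      using \<rho> g' \<beta> r by (intro add_mono mult_right_mono) auto
    finally show ?thesis by (simp add: algebra_simps)
  qed
  have main: "(\<integral>z. f z \<partial>K x) - (\<integral>z. f z \<partial>K y) \<le> \<rho> * s * (2 + \<beta> * L x + \<beta> * L y)"
    if f[measurable]: "f \<in> borel_measurable S" and s: "0 \<le> s" and f1: "\<And>x. x \<in> space S \<Longrightarrow> \<bar>f x\<bar> \<le> 1"
      and osc: "\<And>x y. x \<in> space S \<Longrightarrow> y \<in> space S \<Longrightarrow> \<bar>f x - f y\<bar> \<le> s * (2 + \<beta> * L x + \<beta> * L y)"
      and x: "x \<in> space S" and y: "y \<in> space S" for f s x y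
  proof -
    interpret Kx: prob_space "K x" by (rule prob_space_K[OF x])
    interpret Ky: prob_space "K y" by (rule prob_space_K[OF y])
    define w where "w u = s * (1 + \<beta> * L u)" for u
    \<comment> \<open>The bound on differences says f u - w u is at most f v + w v for all u and v,
      so some constant separates the two sides. Subtracting it changes no difference of integrals
      and turns the oscillation bound into the pointwise bound of |\<psi>| by w.\<close>
    define c where "c = (SUP u\<in>space S. f u - w u)"
    define \<psi> where "\<psi> u = f u - c" for u
    have cross: "f u - w u \<le> f v + w v" if "u \<in> space S" "v \<in> space S" for u v
      using osc[OF that] by (simp add: w_def algebra_simps abs_le_iff)
    have bdd: "bdd_above ((\<lambda>u. f u - w u) ` space S)"
      using cross[OF _ x] by (intro bdd_aboveI2)
    have "f u - w u \<le> c" if "u \<in> space S" for u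
      unfolding c_def using that bdd by (rule cSUP_upper)
    moreover have "c \<le> f v + w v" if "v \<in> space S" for v
      unfolding c_def using x cross that by (intro cSUP_least) auto
    ultimately have \<psi>w: "\<bar>\<psi> u\<bar> \<le> w u" if "u \<in> space S" for u
      using that unfolding \<psi>_def abs_le_iff by (smt (verit))
    have ws: "s \<le> w u" if "u \<in> space S" for u
      unfolding w_def using s \<beta> L_nonneg[OF that] by (simp add: mult_le_cancel_left1 distrib_left)
    have [measurable]: "w \<in> borel_measurable S" "\<psi> \<in> borel_measurable S"
      unfolding w_def \<psi>_def by measurable
    have f_int: "integrable (K u) f" if u: "u \<in> space S" for u
    proof -
      interpret Ku: prob_space "K u" by (rule prob_space_K[OF u])
      show ?thesis
        by (rule Ku.integrable_const_bound[where B=1])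
          (auto intro!: AE_I2 borel_measurable_K[OF u] simp: space_K[OF u] f1)
    qed
    have w_int: "integrable (K u) w" "integrable (K u) \<psi>" "(\<integral>z. \<psi> z \<partial>K u) = (\<integral>z. f z \<partial>K u) - c"
      "(\<integral>z. w z \<partial>K u) \<le> s * (1 + \<beta> * (g * L u + D))" if u: "u \<in> space S" for u
    proof -
      interpret Ku: prob_space "K u" by (rule prob_space_K[OF u])
      show "integrable (K u) w" "integrable (K u) \<psi>" "(\<integral>z. \<psi> z \<partial>K u) = (\<integral>z. f z \<partial>K u) - c"
        unfolding w_def \<psi>_def using integrable_L[OF u] f_int[OF u] by (auto simp: Ku.prob_space)
      have "(\<integral>z. w z \<partial>K u) = s * (1 + \<beta> * (\<integral>z. L z \<partial>K u))"
        unfolding w_def using integrable_L[OF u] by (simp add: Ku.prob_space)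
      then show "(\<integral>z. w z \<partial>K u) \<le> s * (1 + \<beta> * (g * L u + D))"
        using s \<beta> integral_L_le[OF u] by (auto intro!: mult_left_mono)
    qed
    have sum_w: "(\<integral>z. w z \<partial>K x) + (\<integral>z. w z \<partial>K y) \<le> s * (2 + \<beta> * (g * (L x + L y) + 2 * D))"
      using w_int(4)[OF x] w_int(4)[OF y] by (simp add: algebra_simps)
    have diff: "(\<integral>z. f z \<partial>K x) - (\<integral>z. f z \<partial>K y) = (\<integral>z. \<psi> z \<partial>K x) - (\<integral>z. \<psi> z \<partial>K y)"
      using w_int(3) x y by simp
    have "\<exists>t. (\<integral>z. f z \<partial>K x) - (\<integral>z. f z \<partial>K y) \<le> s * t \<and> t \<le> \<rho> * (2 + \<beta> * (L x + L y))"
    proof (cases "R \<le> L x + L y")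
      case True
      have "\<bar>\<integral>z. \<psi> z \<partial>K u\<bar> \<le> (\<integral>z. w z \<partial>K u)" if u: "u \<in> space S" for u
        using \<psi>w w_int(1,2)[OF u]
        by (intro order_trans[OF integral_abs_bound] integral_mono) (auto simp: space_K[OF u])
      from this[OF x] this[OF y]
      have "(\<integral>z. f z \<partial>K x) - (\<integral>z. f z \<partial>K y) \<le> s * (2 + \<beta> * (g * (L x + L y) + 2 * D))"
        using sum_w diff by linarith
      then show ?thesis using far[OF True] by blast
    next
      case False
      then have "L x \<le> R" "L y \<le> R" using L_nonneg[OF x] L_nonneg[OF y] by auto
      from ov[OF x y this] obtain \<eta> where \<eta>: "sets \<eta> = sets S" "ennreal e \<le> emeasure \<eta> (space S)"
        "\<And>A. A \<in> sets S \<Longrightarrow> emeasure \<eta> A \<le> emeasure (K x) A"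
        "\<And>A. A \<in> sets S \<Longrightarrow> emeasure \<eta> A \<le> emeasure (K y) A" by blast
      have "(\<integral>z. \<psi> z \<partial>K x) - (\<integral>z. \<psi> z \<partial>K y) \<le> (\<integral>z. w z \<partial>K x) + (\<integral>z. w z \<partial>K y) - 2 * s * e"
        using e s \<psi>w ws w_int x y by (intro overlap_integral_le[OF x y \<eta>]) auto
      then have "(\<integral>z. f z \<partial>K x) - (\<integral>z. f z \<partial>K y) \<le> s * (2 - 2 * e + \<beta> * (g * (L x + L y) + 2 * D))"
        using sum_w diff by (simp add: algebra_simps)
      then show ?thesis using near[of "L x + L y"] L_nonneg[OF x] L_nonneg[OF y] by auto
    qed
    then obtain t where t: "(\<integral>z. f z \<partial>K x) - (\<integral>z. f z \<partial>K y) \<le> s * t" "t \<le> \<rho> * (2 + \<beta> * (L x + L y))" by blast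
    have "s * t \<le> s * (\<rho> * (2 + \<beta> * (L x + L y)))" using t(2) s by (rule mult_left_mono)
    with t(1) show ?thesis by (simp add: algebra_simps)
  qed
  show ?thesis
  proof (rule exI[of _ \<rho>], rule exI[of _ \<beta>], intro conjI ballI allI impI)
    fix f s x y
    assume f: "f \<in> borel_measurable S" "0 \<le> s" "\<forall>x\<in>space S. \<bar>f x\<bar> \<le> 1"
      "\<forall>x\<in>space S. \<forall>y\<in>space S. \<bar>f x - f y\<bar> \<le> s * (2 + \<beta> * L x + \<beta> * L y)"
      and xy: "x \<in> space S" "y \<in> space S"
    have "(\<integral>z. f z \<partial>K y) - (\<integral>z. f z \<partial>K x) \<le> \<rho> * s * (2 + \<beta> * L x + \<beta> * L y)"
      using main[OF f(1,2) _ _ xy(2,1)] f by (simp add: algebra_simps)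
    moreover have "(\<integral>z. f z \<partial>K x) - (\<integral>z. f z \<partial>K y) \<le> \<rho> * s * (2 + \<beta> * L x + \<beta> * L y)"
      using main[OF f(1,2) _ _ xy] f by blast
    ultimately show "\<bar>(\<integral>z. f z \<partial>K x) - (\<integral>z. f z \<partial>K y)\<bar> \<le> \<rho> * s * (2 + \<beta> * L x + \<beta> * L y)"
      by linarith
  qed (use \<rho> \<beta> in auto)
qed

text \<open>For each set A the m-step probabilities, as a function of the starting point, have been
  contracted m times, at a rate and with a weight that do not depend on A. So the laws started at
  one point \<open>x0\<close> are Cauchy uniformly over all sets, and comparing x with
  \<open>x0\<close> transfers the rate to every starting point.\<close>

theorem harris:
  assumes ne: "space S \<noteq> {}"
  shows "\<exists>\<pi> \<rho> C. invariant_distribution S K \<pi> \<and> 0 < \<rho> \<and> \<rho> < 1 \<and> 0 < C \<and>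
    (\<forall>x\<in>space S. \<forall>m. \<forall>A\<in>sets S. \<bar>measure (kernel_pow S K m x) A - measure \<pi> A\<bar> \<le> C * (1 + L x) * \<rho> ^ m)"
proof -
  obtain \<rho> \<beta> where \<rho>: "0 < \<rho>" "\<rho> < 1" and \<beta>: "0 < \<beta>" and
    contr: "\<forall>f\<in>borel_measurable S. \<forall>s\<ge>0. (\<forall>x\<in>space S. \<bar>f x\<bar> \<le> 1) \<longrightarrow>
      (\<forall>x\<in>space S. \<forall>y\<in>space S. \<bar>f x - f y\<bar> \<le> s * (2 + \<beta> * L x + \<beta> * L y)) \<longrightarrow>
      (\<forall>x\<in>space S. \<forall>y\<in>space S. \<bar>(\<integral>z. f z \<partial>K x) - (\<integral>z. f z \<partial>K y)\<bar> \<le> \<rho> * s * (2 + \<beta> * L x + \<beta> * L y))"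
    using weighted_oscillation_contraction by (elim exE conjE) (rule that; assumption)
  define Q where "Q = kernel_pow S K"
  have Q_meas: "(\<lambda>x. measure (Q m x) A) \<in> borel_measurable S" if "A \<in> sets S" for m A
    unfolding Q_def using that by measurable
  have Q01: "0 \<le> measure (Q m x) A \<and> measure (Q m x) A \<le> 1" if "x \<in> space S" for m x A
    unfolding Q_def using prob_space_kernel_pow[OF that] by (simp add: prob_space.prob_le_1)
  have osc: "\<bar>measure (Q m x) A - measure (Q m y) A\<bar> \<le> \<rho> ^ m * (2 + \<beta> * L x + \<beta> * L y)"
    if A: "A \<in> sets S" and "x \<in> space S" "y \<in> space S" for m x y A
    using that(2,3)
  proof (induction m arbitrary: x y)
    case 0
    have "\<bar>measure (Q 0 x) A - measure (Q 0 y) A\<bar> \<le> 1"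
      using Q01[OF 0(1), of 0 A] Q01[OF 0(2), of 0 A] by linarith
    also have "\<dots> \<le> 2 + \<beta> * L x + \<beta> * L y"
      using \<beta> L_nonneg 0 by (smt (verit) mult_nonneg_nonneg)
    finally show ?case by simp
  next
    case (Suc m)
    have "\<bar>(\<integral>z. measure (Q m z) A \<partial>K x) - (\<integral>z. measure (Q m z) A \<partial>K y)\<bar>
        \<le> \<rho> * \<rho> ^ m * (2 + \<beta> * L x + \<beta> * L y)"
      by (rule contr[rule_format]) (use Suc Q01 \<rho> Q_meas[OF A] in auto)
    then show ?case
      using Suc.prems A unfolding Q_def by (simp only: measure_kernel_pow_Suc(1) power_Suc)
  qed
  obtain x0 where x0: "x0 \<in> space S" using ne by blast
  interpret K0: prob_space "K x0" by (rule prob_space_K[OF x0])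
  \<comment> \<open>A bound for the mean of the weight 2 + \<beta> L y + \<beta> L x0 when y is
    drawn from \<open>K x0\<close>: one step away from \<open>x0\<close>, the law has moved by at
    most this much times the contraction factor.\<close>
  define c0 where "c0 = 2 + \<beta> * L x0 + \<beta> * (g * L x0 + D)"
  have c0: "0 < c0"
    unfolding c0_def using \<beta> L_nonneg[OF x0] g D by (auto intro!: add_pos_nonneg mult_nonneg_nonneg)
  have step: "\<bar>measure (Q (Suc m) x0) A - measure (Q m x0) A\<bar> \<le> c0 * \<rho> ^ m" if A: "A \<in> sets S" for m A
  proof -
    have int: "integrable (K x0) (\<lambda>y. measure (Q m y) A)"
      by (rule K0.integrable_const_bound[where B=1])
        (use Q01 in \<open>auto intro!: AE_I2 borel_measurable_K[OF x0] Q_meas[OF A] simp: space_K[OF x0]\<close>)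
    have "measure (Q (Suc m) x0) A - measure (Q m x0) A
        = (\<integral>y. measure (Q m y) A - measure (Q m x0) A \<partial>K x0)"
      using int unfolding Q_def measure_kernel_pow_Suc(1)[OF x0 A] by (simp add: K0.prob_space)
    also have "\<bar>\<dots>\<bar> \<le> (\<integral>y. \<bar>measure (Q m y) A - measure (Q m x0) A\<bar> \<partial>K x0)"
      by (rule integral_abs_bound)
    also have "\<dots> \<le> (\<integral>y. \<rho> ^ m * (2 + \<beta> * L y + \<beta> * L x0) \<partial>K x0)"
      using int integrable_L[OF x0] osc[OF A _ x0]
      by (intro integral_mono) (auto simp: space_K[OF x0])
    also have "\<dots> = \<rho> ^ m * (2 + \<beta> * (\<integral>y. L y \<partial>K x0) + \<beta> * L x0)"
      using integrable_L[OF x0] by (simp add: K0.prob_space)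
    also have "\<dots> \<le> \<rho> ^ m * c0"
      unfolding c0_def using \<rho> \<beta> integral_L_le[OF x0] by (intro mult_left_mono) auto
    finally show ?thesis by (simp add: mult.commute)
  qed
  define p where "p A = lim (\<lambda>m. measure (Q m x0) A)" for A
  have tail: "\<bar>measure (Q m x0) A - p A\<bar> \<le> c0 / (1 - \<rho>) * \<rho> ^ m" if A: "A \<in> sets S" for m A
  proof -
    define h where "h m = measure (Q m x0) A" for m
    have hstep: "\<bar>h (Suc m) - h m\<bar> \<le> c0 * \<rho> ^ m" for m unfolding h_def by (rule step[OF A])
    \<comment> \<open>The geometric sum is kept in its exact telescoped form, since the induction on
      k would not close with the bare bound c0 / (1 - \<rho>) * \<rho> ^ m.\<close>
    have hk: "\<bar>h (m + k) - h m\<bar> \<le> c0 / (1 - \<rho>) * \<rho> ^ m - c0 / (1 - \<rho>) * \<rho> ^ (m + k)" for m k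
    proof (induction k)
      case (Suc k)
      have "c0 / (1 - \<rho>) * \<rho> ^ (m + k) - c0 / (1 - \<rho>) * \<rho> ^ (m + Suc k)
          = c0 / (1 - \<rho>) * (1 - \<rho>) * \<rho> ^ (m + k)"
        unfolding add_Suc_right power_Suc by (simp only: algebra_simps)
      also have "\<dots> = c0 * \<rho> ^ (m + k)" using \<rho> by simp
      finally have "c0 / (1 - \<rho>) * \<rho> ^ (m + k) - c0 / (1 - \<rho>) * \<rho> ^ (m + Suc k) = c0 * \<rho> ^ (m + k)" .
      then show ?case using Suc hstep[of "m + k"] by simp
    qed simp
    have hk': "\<bar>h n - h m\<bar> \<le> c0 / (1 - \<rho>) * \<rho> ^ m" if "m \<le> n" for m n
    proof -
      have "0 \<le> c0 / (1 - \<rho>) * \<rho> ^ n" using c0 \<rho> by simp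
      then show ?thesis using hk[of m "n - m"] that by simp
    qed
    have "(\<lambda>m. c0 / (1 - \<rho>) * \<rho> ^ m) \<longlonglongrightarrow> c0 / (1 - \<rho>) * 0"
      using \<rho> by (intro tendsto_mult tendsto_const LIMSEQ_realpow_zero) auto
    then have z: "(\<lambda>m. c0 / (1 - \<rho>) * \<rho> ^ m) \<longlonglongrightarrow> 0" by simp
    have "Cauchy h"
    proof (rule CauchyI')
      fix e :: real assume "0 < e"
      with order_tendstoD(2)[OF z, of e] obtain n0 where "c0 / (1 - \<rho>) * \<rho> ^ m < e" if "m \<ge> n0" for m
        by (auto simp: eventually_sequentially)
      then show "\<exists>M. \<forall>m\<ge>M. \<forall>n>m. dist (h m) (h n) < e"
        using le_less_trans[OF hk'] by (intro exI[of _ n0]) (auto simp: dist_real_def abs_minus_commute)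
    qed
    then have lim: "h \<longlonglongrightarrow> p A"
      unfolding p_def h_def[symmetric] by (simp add: Cauchy_convergent_iff convergent_LIMSEQ_iff)
    have "(\<lambda>n. \<bar>h n - h m\<bar>) \<longlonglongrightarrow> \<bar>p A - h m\<bar>" by (intro tendsto_intros lim)
    then have "\<bar>p A - h m\<bar> \<le> c0 / (1 - \<rho>) * \<rho> ^ m"
      by (rule LIMSEQ_le_const2) (use hk' in blast)
    then show ?thesis by (simp add: h_def abs_minus_commute)
  qed
  have "(\<lambda>m. c0 / (1 - \<rho>) * \<rho> ^ m) \<longlonglongrightarrow> c0 / (1 - \<rho>) * 0"
    using \<rho> by (intro tendsto_mult tendsto_const LIMSEQ_realpow_zero) auto
  then have z: "(\<lambda>m. c0 / (1 - \<rho>) * \<rho> ^ m) \<longlonglongrightarrow> 0" by simp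
  have "\<exists>\<pi>. prob_space \<pi> \<and> sets \<pi> = sets S \<and> (\<forall>A\<in>sets S. measure \<pi> A = p A)"
    by (rule prob_space_uniform_limit_exists[OF _ _ tail z])
      (simp_all add: Q_def prob_space_kernel_pow[OF x0] sets_kernel_pow[OF x0])
  then obtain \<pi> where \<pi>: "prob_space \<pi>" "sets \<pi> = sets S" "\<And>A. A \<in> sets S \<Longrightarrow> measure \<pi> A = p A"
    by blast
  interpret \<pi>: prob_space \<pi> by fact
  have sp\<pi>: "space \<pi> = space S" using \<pi>(2) by (rule sets_eq_imp_space_eq)
  have lim: "(\<lambda>m. measure (Q m x0) A) \<longlonglongrightarrow> measure \<pi> A" if "A \<in> sets S" for A
    by (rule metric_tendsto_imp_tendsto[OF z])
      (use order_trans[OF tail[OF that] abs_ge_self] \<pi>(3)[OF that] in \<open>auto simp: dist_real_def intro!: always_eventually\<close>)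
  have K\<pi>: "K \<in> \<pi> \<rightarrow>\<^sub>M subprob_algebra S"
    using measurable_prob_algebraD[OF K] measurable_cong_sets[OF \<pi>(2) refl] by blast
  \<comment> \<open>The probability of A after m + 1 steps is the integral of the [0, 1]-valued
    function y to K y A against the m-step law. Uniform convergence on sets carries this integral to
    the one against \<pi>, while the left side tends to the \<pi> measure of A.\<close>
  have inv: "\<pi> \<bind> K = \<pi>"
  proof (rule measure_eqI)
    show s: "sets (\<pi> \<bind> K) = sets \<pi>"
      using ne \<pi>(2) sp\<pi> by (subst sets_bind_measurable[OF K\<pi>]) auto
    have pb: "prob_space (\<pi> \<bind> K)"
      using \<pi>(1,2) by (intro prob_space_bind'[OF _ K]) (simp add: space_prob_algebra)
    interpret pb: prob_space "\<pi> \<bind> K" by fact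
    fix A assume "A \<in> sets (\<pi> \<bind> K)"
    then have A: "A \<in> sets S" using s \<pi>(2) by simp
    have KA[measurable]: "(\<lambda>y. measure (K y) A) \<in> borel_measurable S" using A by measurable
    have "(\<lambda>m. measure (Q (Suc m) x0) A) \<longlonglongrightarrow> measure (\<pi> \<bind> K) A"
    proof (rule metric_tendsto_imp_tendsto[OF z], rule always_eventually, rule allI)
      fix m
      have "\<bar>(\<integral>y. measure (K y) A \<partial>Q m x0) - (\<integral>y. measure (K y) A \<partial>\<pi>)\<bar> \<le> c0 / (1 - \<rho>) * \<rho> ^ m"
      proof (rule abs_integral_diff_le_of_measure_diff_le)
        show "prob_space (Q m x0)" "sets \<pi> = sets (Q m x0)"
          unfolding Q_def using prob_space_kernel_pow[OF x0] sets_kernel_pow[OF x0] \<pi> by simp_all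
        show "(\<lambda>y. measure (K y) A) \<in> borel_measurable (Q m x0)"
          using KA measurable_cong_sets[OF sets_kernel_pow[OF x0] refl] unfolding Q_def by blast
        show "\<bar>measure (Q m x0) B - measure \<pi> B\<bar> \<le> c0 / (1 - \<rho>) * \<rho> ^ m" if "B \<in> sets (Q m x0)" for B
          using tail[of B m] \<pi>(3)[of B] that sets_kernel_pow[OF x0] unfolding Q_def by simp
        show "0 \<le> measure (K x) A \<and> measure (K x) A \<le> 1" if "x \<in> space (Q m x0)" for x
          using that prob_space_K space_kernel_pow[OF x0] unfolding Q_def by (simp add: prob_space.prob_le_1)
      qed (fact \<pi>)
      then have "\<bar>measure (Q (Suc m) x0) A - measure (\<pi> \<bind> K) A\<bar> \<le> c0 / (1 - \<rho>) * \<rho> ^ m"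
        unfolding Q_def measure_kernel_pow_Suc(2)[OF x0 A] \<pi>.measure_bind[OF K\<pi> A] .
      then show "dist (measure (Q (Suc m) x0) A) (measure (\<pi> \<bind> K) A) \<le> dist (c0 / (1 - \<rho>) * \<rho> ^ m) 0"
        by (metis abs_ge_self diff_zero dist_real_def order_trans)
    qed
    moreover have "(\<lambda>m. measure (Q (Suc m) x0) A) \<longlonglongrightarrow> measure \<pi> A"
      using lim[OF A] by (rule LIMSEQ_Suc)
    ultimately have "measure (\<pi> \<bind> K) A = measure \<pi> A" by (rule LIMSEQ_unique)
    then show "emeasure (\<pi> \<bind> K) A = emeasure \<pi> A"
      by (simp add: pb.emeasure_eq_measure \<pi>.emeasure_eq_measure)
  qed
  define t where "t = c0 / (1 - \<rho>)"
  \<comment> \<open>Chosen so that C * (1 + L x) dominates the oscillation weight between x and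
    \<open>x0\<close> plus the tail constant t.\<close>
  define C where "C = 2 + \<beta> + \<beta> * L x0 + t"
  have t: "0 \<le> t" using c0 \<rho> by (simp add: t_def)
  have C: "0 < C"
    unfolding C_def using \<beta> L_nonneg[OF x0] t by (auto intro!: add_pos_nonneg)
  have "\<bar>measure (Q m x) A - measure \<pi> A\<bar> \<le> C * (1 + L x) * \<rho> ^ m"
    if x: "x \<in> space S" and A: "A \<in> sets S" for x m A
  proof -
    have "\<bar>measure (Q m x) A - measure \<pi> A\<bar>
        \<le> \<rho> ^ m * (2 + \<beta> * L x + \<beta> * L x0) + t * \<rho> ^ m"
      using osc[OF A x x0, of m] tail[OF A, of m] \<pi>(3)[OF A] unfolding t_def by linarith
    also have "\<dots> = (2 + \<beta> * L x + \<beta> * L x0 + t) * \<rho> ^ m"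
      by (simp add: algebra_simps)
    also have "\<dots> \<le> C * (1 + L x) * \<rho> ^ m"
    proof (rule mult_right_mono)
      have "0 \<le> (2 + \<beta> * L x0 + t) * L x"
        using \<beta> L_nonneg[OF x0] L_nonneg[OF x] t by (intro mult_nonneg_nonneg add_nonneg_nonneg) auto
      then show "2 + \<beta> * L x + \<beta> * L x0 + t \<le> C * (1 + L x)"
        unfolding C_def using \<beta> by (simp add: algebra_simps)
    qed (use \<rho> in simp)
    finally show ?thesis .
  qed
  then show ?thesis
    using inv \<pi> \<rho> C unfolding invariant_distribution_def Q_def by blast
qed

end

section \<open>Independence and the Markov property\<close>

lemma rvec_apply: "i \<in> I \<Longrightarrow> rvec I X \<omega> i = X i \<omega>"
  by (simp add: rvec_def)

lemma sets_generated_by: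
  "X \<in> M \<rightarrow>\<^sub>M N \<Longrightarrow> sets (generated_by M X N) = {X -` A \<inter> space M | A. A \<in> sets N}"
  unfolding generated_by_def by (intro sets_vimage_algebra2) (auto dest: measurable_space)

lemma subalgebra_generated_by: "X \<in> M \<rightarrow>\<^sub>M N \<Longrightarrow> subalgebra M (generated_by M X N)"
  unfolding subalgebra_def
  by (auto simp: sets_generated_by intro: measurable_sets) (simp add: generated_by_def)+

context prob_space
begin

text \<open>The two elements may have different value types, which \<^const>\<open>indep_var\<close> does not allow;
  hence independence is stated through the joint law, here and below.\<close>

lemma distr_Pair_compose_indep_var:
  assumes indep: "indep_var N1 X1 N2 X2" and f: "f \<in> N1 \<rightarrow>\<^sub>M S" and h: "h \<in> N2 \<rightarrow>\<^sub>M R"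
  shows "distr M S (\<lambda>\<omega>. f (X1 \<omega>)) \<Otimes>\<^sub>M distr M R (\<lambda>\<omega>. h (X2 \<omega>))
    = distr M (S \<Otimes>\<^sub>M R) (\<lambda>\<omega>. (f (X1 \<omega>), h (X2 \<omega>)))"
proof -
  have X[measurable]: "X1 \<in> M \<rightarrow>\<^sub>M N1" "X2 \<in> M \<rightarrow>\<^sub>M N2"
    using indep indep_var_rv1 indep_var_rv2 by blast+
  note [measurable] = f h
  interpret D: prob_space "distr (distr M N2 X2) R h"
    by (intro prob_space.prob_space_distr prob_space_distr) measurable
  have "distr M S (\<lambda>\<omega>. f (X1 \<omega>)) \<Otimes>\<^sub>M distr M R (\<lambda>\<omega>. h (X2 \<omega>))
      = distr (distr M N1 X1) S f \<Otimes>\<^sub>M distr (distr M N2 X2) R h"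
    by (simp add: distr_distr o_def)
  also have "\<dots> = distr (distr M N1 X1 \<Otimes>\<^sub>M distr M N2 X2) (S \<Otimes>\<^sub>M R) (\<lambda>(x, y). (f x, h y))"
    by (rule pair_measure_distr) (use D.sigma_finite_measure_axioms in auto)
  also have "\<dots> = distr M (S \<Otimes>\<^sub>M R) (\<lambda>\<omega>. (f (X1 \<omega>), h (X2 \<omega>)))"
    using indep unfolding indep_var_distribution_eq by (simp add: distr_distr o_def)
  finally show ?thesis .
qed

text \<open>The freezing principle: given U, the independent W keeps its law while U is treated as a
  constant inside F. Events of the generated sigma-algebra are preimages under U, so the defining
  identity of the conditional expectation is Fubini for the product law.\<close>

lemma real_cond_exp_generated_by_indep:
  assumes U[measurable]: "U \<in> M \<rightarrow>\<^sub>M S" and W[measurable]: "W \<in> M \<rightarrow>\<^sub>M R"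
    and joint: "distr M S U \<Otimes>\<^sub>M distr M R W = distr M (S \<Otimes>\<^sub>M R) (\<lambda>\<omega>. (U \<omega>, W \<omega>))"
    and F[measurable]: "F \<in> S \<Otimes>\<^sub>M R \<rightarrow>\<^sub>M N" and A[measurable]: "A \<in> sets N"
  shows "AE \<omega> in M. real_cond_exp M (generated_by M U S) (\<lambda>\<omega>. indicator A (F (U \<omega>, W \<omega>))) \<omega>
    = measure (distr (distr M R W) N (\<lambda>w. F (U \<omega>, w))) A"
proof -
  interpret U: prob_space "distr M S U" by (rule prob_space_distr[OF U])
  interpret W: prob_space "distr M R W" by (rule prob_space_distr[OF W])
  interpret UW: pair_prob_space "distr M S U" "distr M R W" ..
  interpret F: finite_measure_subalgebra M "generated_by M U S"
    by unfold_locales (rule subalgebra_generated_by[OF U])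
  define h where "h u = (\<integral>w. indicator A (F (u, w)) \<partial>distr M R W :: real)" for u
  have h_eq: "measure (distr (distr M R W) N (\<lambda>w. F (u, w))) A = h u" if "u \<in> space S" for u
  proof -
    have [measurable]: "(\<lambda>w. F (u, w)) \<in> distr M R W \<rightarrow>\<^sub>M N" using that by measurable
    have "measure (distr (distr M R W) N (\<lambda>w. F (u, w))) A
        = (\<integral>z. indicator A z \<partial>distr (distr M R W) N (\<lambda>w. F (u, w)))" by simp
    also have "\<dots> = h u" unfolding h_def by (rule integral_distr) measurable
    finally show ?thesis .
  qed
  have h_meas[measurable]: "h \<in> borel_measurable S"
    unfolding h_def by (rule W.borel_measurable_lebesgue_integral) measurable
  have h01: "0 \<le> h u \<and> h u \<le> 1" if "u \<in> space S" for u
    unfolding h_eq[OF that, symmetric] using that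
    by (auto intro!: prob_space.prob_le_1 W.prob_space_distr)
  have gh: "(\<lambda>\<omega>. h (U \<omega>)) \<in> borel_measurable (generated_by M U S)"
    unfolding generated_by_def
    by (rule measurable_compose[OF measurable_vimage_algebra1 h_meas]) (auto dest: measurable_space[OF U])
  have "AE \<omega> in M. real_cond_exp M (generated_by M U S) (\<lambda>\<omega>. indicator A (F (U \<omega>, W \<omega>))) \<omega> = h (U \<omega>)"
  proof (rule F.real_cond_exp_charact)
    show "integrable M (\<lambda>\<omega>. indicator A (F (U \<omega>, W \<omega>)) :: real)"
      by (rule integrable_const_bound[where B=1]) (auto intro!: AE_I2 simp: indicator_def)
    show "integrable M (\<lambda>\<omega>. h (U \<omega>))"
      by (rule integrable_const_bound[where B=1]) (auto intro!: AE_I2 simp: h01 measurable_space[OF U])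
    fix B assume "B \<in> sets (generated_by M U S)"
    then obtain C where C[measurable]: "C \<in> sets S" and B: "B = U -` C \<inter> space M"
      by (auto simp: sets_generated_by[OF U])
    define k :: "_ \<Rightarrow> real" where "k = (\<lambda>(u, w). indicator C u * indicator A (F (u, w)))"
    have k[measurable]: "k \<in> borel_measurable (S \<Otimes>\<^sub>M R)" unfolding k_def by measurable
    have k_int: "integrable (distr M S U \<Otimes>\<^sub>M distr M R W) k"
      by (rule UW.integrable_const_bound[where B=1]) (auto intro!: AE_I2 simp: k_def indicator_def)
    have "(\<integral>\<omega>\<in>B. indicator A (F (U \<omega>, W \<omega>)) \<partial>M) = (\<integral>\<omega>. k (U \<omega>, W \<omega>) \<partial>M)"
      unfolding set_lebesgue_integral_def B k_def by (intro Bochner_Integration.integral_cong) (auto simp: indicator_def)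
    also have "\<dots> = (\<integral>z. k z \<partial>(distr M S U \<Otimes>\<^sub>M distr M R W))"
      unfolding joint by (subst integral_distr) auto
    also have "\<dots> = (\<integral>u. (\<integral>w. k (u, w) \<partial>distr M R W) \<partial>distr M S U)"
      by (rule UW.integral_fst'[OF k_int, symmetric])
    also have "\<dots> = (\<integral>u. indicator C u * h u \<partial>distr M S U)"
      unfolding k_def h_def by simp
    also have "\<dots> = (\<integral>\<omega>. indicator C (U \<omega>) * h (U \<omega>) \<partial>M)"
      by (rule integral_distr) measurable
    also have "\<dots> = (\<integral>\<omega>\<in>B. h (U \<omega>) \<partial>M)"
      unfolding set_lebesgue_integral_def B by (intro Bochner_Integration.integral_cong) (auto simp: indicator_def)
    finally show "(\<integral>\<omega>\<in>B. indicator A (F (U \<omega>, W \<omega>)) \<partial>M) = (\<integral>\<omega>\<in>B. h (U \<omega>) \<partial>M)" .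
  qed (rule gh)
  moreover have "AE \<omega> in M. U \<omega> \<in> space S" by (rule AE_I2) (rule measurable_space[OF U])
  ultimately show ?thesis by eventually_elim (simp add: h_eq)
qed

text \<open>Links the two levels of independence: a cylinder event over one family belongs to the
  sigma-algebra of that whole family, to which the independence between families applies, and its
  probability already factorises within the family.\<close>

lemma cylinder_generated_by_family:
  assumes indep: "indep_vars (\<lambda>_. N) X I" and e: "e \<in> N \<rightarrow>\<^sub>M T"
    and H: "finite H" "H \<subseteq> I" and B: "\<And>m. m \<in> H \<Longrightarrow> B m \<in> sets T"
  defines "E \<equiv> {\<omega> \<in> space M. \<forall>m\<in>H. e (X m \<omega>) \<in> B m}"
  shows "E \<in> sets (generated_by M (rvec I X) (PiM I (\<lambda>_. N)))"
    and "prob E = (\<Prod>m\<in>H. prob {\<omega> \<in> space M. e (X m \<omega>) \<in> B m})"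
proof -
  have X: "X m \<in> M \<rightarrow>\<^sub>M N" if "m \<in> I" for m
    using indep that by (auto simp: indep_vars_def)
  have rv: "rvec I X \<in> M \<rightarrow>\<^sub>M PiM I (\<lambda>_. N)"
    unfolding rvec_def by (intro measurable_restrict X)
  define C where "C = {z \<in> space (PiM I (\<lambda>_. N)). \<forall>m\<in>H. e (z m) \<in> B m}"
  have "C \<in> sets (PiM I (\<lambda>_. N))"
    unfolding C_def
  proof (rule sets.sets_Collect_finite_All[OF _ H(1)])
    fix m assume m: "m \<in> H"
    have "(\<lambda>z. e (z m)) \<in> PiM I (\<lambda>_. N) \<rightarrow>\<^sub>M T"
      by (rule measurable_compose[OF _ e]) (use m H in \<open>auto intro!: measurable_component_singleton\<close>)
    from measurable_sets[OF this B[OF m]]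
    show "{z \<in> space (PiM I (\<lambda>_. N)). e (z m) \<in> B m} \<in> sets (PiM I (\<lambda>_. N))"
      by (simp add: vimage_def Int_def conj_commute)
  qed
  moreover have "E = rvec I X -` C \<inter> space M"
    using measurable_space[OF rv] H unfolding E_def C_def by (auto simp: rvec_apply subset_iff)
  ultimately show "E \<in> sets (generated_by M (rvec I X) (PiM I (\<lambda>_. N)))"
    using sets_generated_by[OF rv] by blast
  show "prob E = (\<Prod>m\<in>H. prob {\<omega> \<in> space M. e (X m \<omega>) \<in> B m})"
  proof (cases "H = {}")
    \<comment> \<open>\<open>indep_varsD\<close> needs a nonempty index set. The empty case does
      occur later, for a family of which a chosen finite index set contains no member.\<close>
    case True
    then show ?thesis by (simp add: E_def prob_space)
  next
    case False
    have "prob (\<Inter>m\<in>H. (e \<circ> X m) -` B m \<inter> space M) = (\<Prod>m\<in>H. prob ((e \<circ> X m) -` B m \<inter> space M))"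
      using H B False by (intro indep_varsD[OF indep_vars_compose[OF indep e]]) auto
    moreover have "(\<Inter>m\<in>H. (e \<circ> X m) -` B m \<inter> space M) = E"
      using False by (auto simp: E_def)
    moreover have "(e \<circ> X m) -` B m \<inter> space M = {\<omega> \<in> space M. e (X m \<omega>) \<in> B m}" for m by auto
    ultimately show ?thesis by simp
  qed
qed

text \<open>The maps \<open>e1\<close>, \<open>e2\<close>, \<open>e3\<close> bring the families into one value space, as
  \<^const>\<open>indep_vars\<close> requires.\<close>

lemma indep_vars_three_families:
  fixes X1 :: "'i \<Rightarrow> 'a \<Rightarrow> 'b" and X2 :: "'i \<Rightarrow> 'a \<Rightarrow> 'c" and X3 :: "'i \<Rightarrow> 'a \<Rightarrow> 'd"
  assumes indep: "indep_vars (\<lambda>_. N1) X1 I" "indep_vars (\<lambda>_. N2) X2 I" "indep_vars (\<lambda>_. N3) X3 I"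
    and three: "indep_three M (PiM I (\<lambda>_. N1)) (rvec I X1) (PiM I (\<lambda>_. N2)) (rvec I X2) (PiM I (\<lambda>_. N3)) (rvec I X3)"
    and e: "e1 \<in> N1 \<rightarrow>\<^sub>M T" "e2 \<in> N2 \<rightarrow>\<^sub>M T" "e3 \<in> N3 \<rightarrow>\<^sub>M T"
  defines "X \<equiv> \<lambda>(k, m) \<omega>. [e1 (X1 m \<omega>), e2 (X2 m \<omega>), e3 (X3 m \<omega>)] ! k"
  shows "indep_vars (\<lambda>_. T) X ({..<3::nat} \<times> I)"
proof -
  have k3: "k < 3 \<longleftrightarrow> k = 0 \<or> k = Suc 0 \<or> k = Suc (Suc 0)" for k :: nat by auto
  have X_simps: "X (0, m) = (\<lambda>\<omega>. e1 (X1 m \<omega>))" "X (Suc 0, m) = (\<lambda>\<omega>. e2 (X2 m \<omega>))" "X (Suc (Suc 0), m) = (\<lambda>\<omega>. e3 (X3 m \<omega>))" for m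
    by (simp_all add: X_def)
  have X: "X j \<in> M \<rightarrow>\<^sub>M T" if "j \<in> {..<3} \<times> I" for j
  proof -
    have "X1 m \<in> M \<rightarrow>\<^sub>M N1" "X2 m \<in> M \<rightarrow>\<^sub>M N2" "X3 m \<in> M \<rightarrow>\<^sub>M N3" if "m \<in> I" for m
      using indep that by (auto simp: indep_vars_def)
    then show ?thesis
      using that e by (cases j) (auto simp: k3 X_simps intro: measurable_compose)
  qed
  show ?thesis
    unfolding indep_vars_def2
  proof (intro conjI ballI X indep_setsI)
    show "{X j -` B \<inter> space M |B. B \<in> sets T} \<subseteq> events" if "j \<in> {..<3} \<times> I" for j
      using X[OF that] by auto
    fix A J assume J: "J \<noteq> {}" "J \<subseteq> {..<3} \<times> I" "finite J"
      and A: "\<forall>j\<in>J. A j \<in> {X j -` B \<inter> space M |B. B \<in> sets T}"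
    from A have "\<forall>j\<in>J. \<exists>B. A j = {\<omega> \<in> space M. X j \<omega> \<in> B} \<and> B \<in> sets T"
      by (force simp: vimage_def Int_def conj_commute)
    then obtain B where B: "\<And>j. j \<in> J \<Longrightarrow> A j = {\<omega> \<in> space M. X j \<omega> \<in> B j}" "\<And>j. j \<in> J \<Longrightarrow> B j \<in> sets T"
      by metis
    \<comment> \<open>The finite set \<open>J\<close> is split by families. Its event is the
      intersection of one cylinder per family, so the probability factors first over k and then over
      m.\<close>
    define H where "H k = {m. (k, m) \<in> J}" for k
    define E where "E k = {\<omega> \<in> space M. \<forall>m\<in>H k. X (k, m) \<omega> \<in> B (k, m)}" for k
    have fin: "finite (H k)" for k
      unfolding H_def using finite_imageI[OF J(3), of snd] by (rule finite_subset[rotated]) force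
    have sub: "H k \<subseteq> I" for k using J by (auto simp: H_def)
    have Bk: "B (k, m) \<in> sets T" if "m \<in> H k" for k m using that B by (auto simp: H_def)
    define G where "G = (\<lambda>k. [sets (generated_by M (rvec I X1) (PiM I (\<lambda>_. N1))), sets (generated_by M (rvec I X2) (PiM I (\<lambda>_. N2))), sets (generated_by M (rvec I X3) (PiM I (\<lambda>_. N3)))] ! k)"
    have E: "E k \<in> G k \<and> prob (E k) = (\<Prod>m\<in>H k. prob {\<omega> \<in> space M. X (k, m) \<omega> \<in> B (k, m)})" if "k < 3" for k
      using that cylinder_generated_by_family[where B="\<lambda>m. B (0, m)", OF indep(1) e(1) fin sub Bk]
        cylinder_generated_by_family[where B="\<lambda>m. B (Suc 0, m)", OF indep(2) e(2) fin sub Bk]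
        cylinder_generated_by_family[where B="\<lambda>m. B (Suc (Suc 0), m)", OF indep(3) e(3) fin sub Bk]
      unfolding k3 by (auto simp: E_def G_def X_simps)
    have JH: "J = Sigma {..<3} H" using J by (auto simp: H_def)
    have "(\<Inter>j\<in>J. A j) = (\<Inter>k\<in>{..<3}. E k)"
    proof
      show "(\<Inter>j\<in>J. A j) \<subseteq> (\<Inter>k\<in>{..<3}. E k)"
        using J(1) B(1) by (fastforce simp: E_def H_def)
      show "(\<Inter>k\<in>{..<3}. E k) \<subseteq> (\<Inter>j\<in>J. A j)"
        unfolding JH using B(1) by (auto simp: E_def JH)
    qed
    then have "prob (\<Inter>j\<in>J. A j) = prob (\<Inter>k\<in>{..<3}. E k)" by simp
    also have "\<dots> = (\<Prod>k\<in>{..<3}. prob (E k))"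
      using three E unfolding indep_three_def G_def[symmetric]
      by (intro indep_setsD[where F=G and I="{..<3}"]) (auto simp: lessThan_empty_iff)
    also have "\<dots> = (\<Prod>k\<in>{..<3}. \<Prod>m\<in>H k. prob (A (k, m)))"
      using E B(1) by (intro prod.cong) (auto simp: H_def intro!: prod.cong)
    also have "\<dots> = (\<Prod>j\<in>J. prob (A j))"
      unfolding JH by (subst prod.Sigma) (auto simp: fin)
    finally show "prob (\<Inter>j\<in>J. A j) = (\<Prod>j\<in>J. prob (A j))" .
  qed
qed

end

section \<open>The chain as a function of its inputs\<close>

lemma measurable_component_component:
  assumes "c \<in> A" "i \<in> B"
  shows "(\<lambda>z. z c i) \<in> PiM A (\<lambda>_. PiM B (\<lambda>_. N)) \<rightarrow>\<^sub>M N"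
  by (rule measurable_compose[OF measurable_component_singleton[OF assms(1)] measurable_component_singleton[OF assms(2)]])

text \<open>\<open>\<theta> m\<close> enters as a constant vector so that all inputs share one value
  space; coordinate 1, present because n is positive, recovers it. The laws T, Q and P do not depend
  on m, which makes the chain homogeneous in time.\<close>

locale mean_chain_model = prob_space M
  for M :: "'w measure" and n :: nat and \<theta> :: "nat \<Rightarrow> 'w \<Rightarrow> real" and q Y :: "nat \<Rightarrow> nat \<Rightarrow> 'w \<Rightarrow> real"
    and T :: "real measure" and Q P :: "(nat \<Rightarrow> real) measure" +
  assumes n: "1 \<le> n"
    and indep: "indep_vars (\<lambda>_. PiM {1..n} (\<lambda>_. borel))
      (\<lambda>(k, m) \<omega>. [\<lambda>i\<in>{1..n}. \<theta> m \<omega>, rvec {1..n} (q m) \<omega>, rvec {1..n} (Y m) \<omega>] ! k) ({..<3::nat} \<times> {1..})"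
    and law_\<theta>: "\<And>m. 1 \<le> m \<Longrightarrow> distr M borel (\<theta> m) = T"
    and law_q: "\<And>m. 1 \<le> m \<Longrightarrow> distr M (PiM {1..n} (\<lambda>_. borel)) (rvec {1..n} (q m)) = Q"
    and law_Y: "\<And>m. 1 \<le> m \<Longrightarrow> distr M (PiM {1..n} (\<lambda>_. borel)) (rvec {1..n} (Y m)) = P"
begin

declare One_nat_def [simp del]

definition V :: "nat \<Rightarrow> 'w \<Rightarrow> real" where
  "V m \<omega> = (\<Sum>i=1..n. q m i \<omega> * Y m i \<omega>)"

definition law_V :: "real measure" where
  "law_V = distr (Q \<Otimes>\<^sub>M P) borel (\<lambda>(a, b). \<Sum>i=1..n. a i * b i)"

abbreviation "R \<equiv> PiM {1..n} (\<lambda>_. borel :: real measure)"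

abbreviation "X \<equiv> \<lambda>(k, m) \<omega>. [\<lambda>i\<in>{1..n}. \<theta> m \<omega>, rvec {1..n} (q m) \<omega>, rvec {1..n} (Y m) \<omega>] ! k"

lemma one_in: "1 \<in> {1..n}" "Suc 0 \<in> {1..n}"
  using n by auto

lemma indep_\<theta>_V:
  assumes m: "1 \<le> m"
  shows "indep_var borel (\<theta> m) borel (V m)"
proof -
  let ?A = "{(0::nat, m)}" and ?B = "{(1::nat, m), (2, m)}"
  have "indep_var (PiM ?A (\<lambda>_. R)) (\<lambda>\<omega>. \<lambda>j\<in>?A. X j \<omega>) (PiM ?B (\<lambda>_. R)) (\<lambda>\<omega>. \<lambda>j\<in>?B. X j \<omega>)"
    by (rule indep_var_restrict[OF indep]) (use m in auto)
  moreover have "(\<lambda>z. z (0, m) 1) \<in> PiM ?A (\<lambda>_. R) \<rightarrow>\<^sub>M borel"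
    by (rule measurable_component_component) (use one_in in auto)
  moreover have "(\<lambda>z. \<Sum>i=1..n. z (1, m) i * z (2, m) i) \<in> PiM ?B (\<lambda>_. R) \<rightarrow>\<^sub>M borel"
    by (intro borel_measurable_sum borel_measurable_times measurable_component_component) auto
  ultimately have "indep_var borel ((\<lambda>z. z (0, m) 1) \<circ> (\<lambda>\<omega>. \<lambda>j\<in>?A. X j \<omega>))
      borel ((\<lambda>z. \<Sum>i=1..n. z (1, m) i * z (2, m) i) \<circ> (\<lambda>\<omega>. \<lambda>j\<in>?B. X j \<omega>))"
    by (rule indep_var_compose)
  also have "(\<lambda>z. z (0, m) 1) \<circ> (\<lambda>\<omega>. \<lambda>j\<in>?A. X j \<omega>) = \<theta> m"
    using one_in by (auto simp: fun_eq_iff)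
  also have "(\<lambda>z. \<Sum>i=1..n. z (1, m) i * z (2, m) i) \<circ> (\<lambda>\<omega>. \<lambda>j\<in>?B. X j \<omega>) = V m"
    by (auto simp: fun_eq_iff V_def rvec_apply intro!: sum.cong)
  finally show ?thesis .
qed

lemma measurable_\<theta>: "1 \<le> m \<Longrightarrow> \<theta> m \<in> borel_measurable M"
  and measurable_V: "1 \<le> m \<Longrightarrow> V m \<in> borel_measurable M"
  using indep_\<theta>_V indep_var_rv1 indep_var_rv2 by blast+

lemma measurable_rvec_q: "1 \<le> m \<Longrightarrow> rvec {1..n} (q m) \<in> M \<rightarrow>\<^sub>M R"
  and measurable_rvec_Y: "1 \<le> m \<Longrightarrow> rvec {1..n} (Y m) \<in> M \<rightarrow>\<^sub>M R"
proof -
  assume m: "1 \<le> m"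
  have "\<forall>j\<in>{..<3} \<times> {1..}. X j \<in> M \<rightarrow>\<^sub>M R" using indep unfolding indep_vars_def by blast
  from bspec[OF this, of "(1, m)"] bspec[OF this, of "(2, m)"] m
  show "rvec {1..n} (q m) \<in> M \<rightarrow>\<^sub>M R" "rvec {1..n} (Y m) \<in> M \<rightarrow>\<^sub>M R" by simp_all
qed

lemma joint_q_Y:
  assumes m: "1 \<le> m"
  shows "Q \<Otimes>\<^sub>M P = distr M (R \<Otimes>\<^sub>M R) (\<lambda>\<omega>. (rvec {1..n} (q m) \<omega>, rvec {1..n} (Y m) \<omega>))"
proof -
  let ?A = "{(1::nat, m)}" and ?B = "{(2::nat, m)}"
  have "indep_var (PiM ?A (\<lambda>_. R)) (\<lambda>\<omega>. \<lambda>j\<in>?A. X j \<omega>) (PiM ?B (\<lambda>_. R)) (\<lambda>\<omega>. \<lambda>j\<in>?B. X j \<omega>)"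
    by (rule indep_var_restrict[OF indep]) (use m in auto)
  moreover have "(\<lambda>z. z (1, m)) \<in> PiM ?A (\<lambda>_. R) \<rightarrow>\<^sub>M R" "(\<lambda>z. z (2, m)) \<in> PiM ?B (\<lambda>_. R) \<rightarrow>\<^sub>M R"
    by (rule measurable_component_singleton; simp)+
  ultimately have "indep_var R ((\<lambda>z. z (1, m)) \<circ> (\<lambda>\<omega>. \<lambda>j\<in>?A. X j \<omega>)) R ((\<lambda>z. z (2, m)) \<circ> (\<lambda>\<omega>. \<lambda>j\<in>?B. X j \<omega>))"
    by (rule indep_var_compose)
  also have "(\<lambda>z. z (1, m)) \<circ> (\<lambda>\<omega>. \<lambda>j\<in>?A. X j \<omega>) = rvec {1..n} (q m)"
    by (auto simp: fun_eq_iff)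
  also have "(\<lambda>z. z (2, m)) \<circ> (\<lambda>\<omega>. \<lambda>j\<in>?B. X j \<omega>) = rvec {1..n} (Y m)"
    by (auto simp: fun_eq_iff)
  finally show ?thesis
    unfolding indep_var_distribution_eq law_q[OF m] law_Y[OF m] by blast
qed

lemma distr_V:
  assumes m: "1 \<le> m"
  shows "distr M borel (V m) = law_V"
proof -
  have [measurable]: "(\<lambda>(a, b). \<Sum>i=1..n. a i * b i) \<in> R \<Otimes>\<^sub>M R \<rightarrow>\<^sub>M (borel :: real measure)"
    by measurable
  note [measurable] = measurable_rvec_q[OF m] measurable_rvec_Y[OF m]
  show ?thesis
    unfolding law_V_def joint_q_Y[OF m]
    by (subst distr_distr) (auto simp: o_def V_def[abs_def] rvec_apply intro!: distr_cong sum.cong)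
qed

lemma distr_\<theta>_V:
  assumes m: "1 \<le> m"
  shows "distr M (borel \<Otimes>\<^sub>M borel) (\<lambda>\<omega>. (\<theta> m \<omega>, V m \<omega>)) = T \<Otimes>\<^sub>M law_V"
  using indep_\<theta>_V[OF m] unfolding indep_var_distribution_eq law_\<theta>[OF m] distr_V[OF m] by simp

lemma prob_space_T: "prob_space T"
  and sets_T: "sets T = sets borel"
  using prob_space_distr[OF measurable_\<theta>[of 1]] sets_distr[of M borel "\<theta> 1"] law_\<theta>[of 1] by auto

lemma prob_space_law_V: "prob_space law_V"
  and sets_law_V: "sets law_V = sets borel"
  using prob_space_distr[OF measurable_V[of 1]] sets_distr[of M borel "V 1"] distr_V[of 1] by auto

text \<open>The path up to time m is a function of the inputs with times 1 to m, the new pair a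
  function of those with time m + 1. The two blocks of indices are disjoint.\<close>

lemma indep_past_\<theta>_V:
  fixes x :: real and m :: nat
  defines "U \<equiv> rvec {..m} (mean_chain n \<theta> q Y x)" and "W \<equiv> \<lambda>\<omega>. (\<theta> (Suc m) \<omega>, V (Suc m) \<omega>)"
  shows "U \<in> M \<rightarrow>\<^sub>M PiM {..m} (\<lambda>_. borel)" and "W \<in> M \<rightarrow>\<^sub>M borel \<Otimes>\<^sub>M borel"
    and "distr M (PiM {..m} (\<lambda>_. borel)) U \<Otimes>\<^sub>M distr M (borel \<Otimes>\<^sub>M borel) W
      = distr M (PiM {..m} (\<lambda>_. borel) \<Otimes>\<^sub>M (borel \<Otimes>\<^sub>M borel)) (\<lambda>\<omega>. (U \<omega>, W \<omega>))"
proof -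
  define A B where "A = {..<3::nat} \<times> {1..m}" and "B = {..<3::nat} \<times> {Suc m}"
  \<comment> \<open>The recursion itself, run on the space of input values: coordinate projections
    take the place of the random variables. This exhibits the chain as a measurable function of the
    inputs.\<close>
  define G where "G = mean_chain n (\<lambda>j z. z (0::nat, j) 1) (\<lambda>j i z. z (1, j) i) (\<lambda>j i z. z (2, j) i) x"
  define H where "H z = (z (0::nat, Suc m) 1, \<Sum>i=1..n. z (1, Suc m) i * z (2, Suc m) i)"
    for z :: "nat \<times> nat \<Rightarrow> nat \<Rightarrow> real"
  have ind: "indep_var (PiM A (\<lambda>_. R)) (\<lambda>\<omega>. \<lambda>j\<in>A. X j \<omega>) (PiM B (\<lambda>_. R)) (\<lambda>\<omega>. \<lambda>j\<in>B. X j \<omega>)"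
    by (rule indep_var_restrict[OF indep]) (auto simp: A_def B_def)
  have G: "rvec {..m} G \<in> PiM A (\<lambda>_. R) \<rightarrow>\<^sub>M PiM {..m} (\<lambda>_. borel)"
  proof -
    have "G k \<in> PiM A (\<lambda>_. R) \<rightarrow>\<^sub>M borel" if "k \<le> m" for k
      using that
    proof (induction k)
      case (Suc k)
      then have "G k \<in> PiM A (\<lambda>_. R) \<rightarrow>\<^sub>M borel" by simp
      then have "(\<lambda>z. z (0, Suc k) 1 * (\<Sum>i=1..n. z (1, Suc k) i * z (2, Suc k) i)
          + (1 - z (0, Suc k) 1) * G k z) \<in> PiM A (\<lambda>_. R) \<rightarrow>\<^sub>M borel"
        using Suc.prems one_in
        by (intro borel_measurable_add borel_measurable_diff borel_measurable_times borel_measurable_sum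
            borel_measurable_const measurable_component_component) (auto simp: A_def)
      moreover have "G (Suc k) = (\<lambda>z. z (0, Suc k) 1 * (\<Sum>i=1..n. z (1, Suc k) i * z (2, Suc k) i)
          + (1 - z (0, Suc k) 1) * G k z)"
        by (simp add: fun_eq_iff G_def)
      ultimately show ?case by simp
    next
      case 0
      have "G 0 = (\<lambda>z. x)" by (simp add: fun_eq_iff G_def)
      then show ?case by simp
    qed
    then show ?thesis unfolding rvec_def by (intro measurable_restrict) auto
  qed
  have H: "H \<in> PiM B (\<lambda>_. R) \<rightarrow>\<^sub>M borel \<Otimes>\<^sub>M borel"
    unfolding H_def[abs_def] using one_in
    by (intro measurable_Pair borel_measurable_times borel_measurable_sum measurable_component_component) (auto simp: B_def)
  have U: "U = (\<lambda>\<omega>. rvec {..m} G (\<lambda>j\<in>A. X j \<omega>))"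
  proof -
    have "G k (\<lambda>j\<in>A. X j \<omega>) = mean_chain n \<theta> q Y x k \<omega>" if "k \<le> m" for k \<omega>
      using that
    proof (induction k)
      case (Suc k)
      have in_A: "(0, Suc k) \<in> A" "(1, Suc k) \<in> A" "(Suc 0, Suc k) \<in> A" "(2, Suc k) \<in> A"
        using Suc.prems by (auto simp: A_def)
      have "G (Suc k) (\<lambda>j\<in>A. X j \<omega>) = \<theta> (Suc k) \<omega> * (\<Sum>i=1..n. q (Suc k) i \<omega> * Y (Suc k) i \<omega>)
          + (1 - \<theta> (Suc k) \<omega>) * G k (\<lambda>j\<in>A. X j \<omega>)"
        using in_A one_in by (simp add: G_def rvec_apply)
      then show ?case unfolding mean_chain.simps Suc.IH[OF Suc_leD[OF Suc.prems]] .
    qed (simp add: G_def)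
    then show ?thesis by (auto simp: fun_eq_iff U_def rvec_def restrict_def)
  qed
  have W: "W = (\<lambda>\<omega>. H (\<lambda>j\<in>B. X j \<omega>))"
    using one_in by (auto simp: fun_eq_iff W_def H_def V_def B_def rvec_apply intro!: sum.cong)
  show "U \<in> M \<rightarrow>\<^sub>M PiM {..m} (\<lambda>_. borel)"
    unfolding U by (rule measurable_compose[OF indep_var_rv1[OF ind] G])
  show "W \<in> M \<rightarrow>\<^sub>M borel \<Otimes>\<^sub>M borel"
    unfolding W by (rule measurable_compose[OF indep_var_rv2[OF ind] H])
  show "distr M (PiM {..m} (\<lambda>_. borel)) U \<Otimes>\<^sub>M distr M (borel \<Otimes>\<^sub>M borel) W
      = distr M (PiM {..m} (\<lambda>_. borel) \<Otimes>\<^sub>M (borel \<Otimes>\<^sub>M borel)) (\<lambda>\<omega>. (U \<omega>, W \<omega>))"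
    unfolding U W by (rule distr_Pair_compose_indep_var[OF ind G H])
qed

text \<open>\<open>mean_kernel\<close> is built from the variables of time 1. This form mentions
  only their laws, so the same kernel can be recognised at every time step.\<close>

definition K :: "real \<Rightarrow> real measure" where
  "K x = distr (T \<Otimes>\<^sub>M law_V) borel (\<lambda>(t, v). t * v + (1 - t) * x)"

lemma mean_kernel_eq: "mean_kernel M n \<theta> q Y = K"
proof
  fix x
  have [measurable]: "(\<lambda>(t, v). t * v + (1 - t) * x) \<in> borel \<Otimes>\<^sub>M borel \<rightarrow>\<^sub>M (borel :: real measure)"
    by measurable
  note [measurable] = measurable_\<theta>[of 1] measurable_V[of 1]
  have "mean_chain n \<theta> q Y x 1 = (\<lambda>(t, v). t * v + (1 - t) * x) \<circ> (\<lambda>\<omega>. (\<theta> 1 \<omega>, V 1 \<omega>))"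
    by (auto simp: fun_eq_iff V_def One_nat_def)
  then show "mean_kernel M n \<theta> q Y x = K x"
    unfolding mean_kernel_def K_def distr_\<theta>_V[OF order_refl, symmetric] by (subst distr_distr) auto
qed

lemma T_law_V_in_prob_algebra: "T \<Otimes>\<^sub>M law_V \<in> space (prob_algebra (borel \<Otimes>\<^sub>M borel))"
  using prob_space_pair[OF prob_space_T prob_space_law_V] sets_pair_measure_cong[OF sets_T sets_law_V]
  by (simp add: space_prob_algebra)

lemma measurable_K: "K \<in> borel \<rightarrow>\<^sub>M prob_algebra borel"
  unfolding K_def[abs_def]
  by (rule measurable_distr_prob_space2[where M="borel \<Otimes>\<^sub>M borel"])
    (use T_law_V_in_prob_algebra in \<open>auto intro!: measurable_const\<close>)

sublocale K: markov_kernel borel K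
  by unfold_locales (rule measurable_K)

lemma measurable_mean_chain: "mean_chain n \<theta> q Y x m \<in> borel_measurable M"
proof -
  have "(\<lambda>\<omega>. rvec {..m} (mean_chain n \<theta> q Y x) \<omega> m) \<in> borel_measurable M"
    by (rule measurable_compose[OF indep_past_\<theta>_V(1) measurable_component_singleton]) simp
  then show ?thesis by (simp add: rvec_apply)
qed

text \<open>The next value is a function of the last entry of the past and of the fresh pair, which
  is independent of the past; freezing the past gives the kernel at the current state.\<close>

lemma markov_chain_mean_chain: "markov_chain M borel K (mean_chain n \<theta> q Y x)"
  unfolding markov_chain_def
proof (intro conjI allI ballI measurable_K measurable_mean_chain)
  fix m and A :: "real set" assume A: "A \<in> sets borel"
  define F :: "(nat \<Rightarrow> real) \<times> real \<times> real \<Rightarrow> real" where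
    "F = (\<lambda>(u, t, v). t * v + (1 - t) * u m)"
  have 1: "1 \<le> Suc m" by simp
  have F: "F \<in> PiM {..m} (\<lambda>_. borel) \<Otimes>\<^sub>M (borel \<Otimes>\<^sub>M borel) \<rightarrow>\<^sub>M borel"
    unfolding F_def by measurable
  have "K (mean_chain n \<theta> q Y x m \<omega>) = distr (distr M (borel \<Otimes>\<^sub>M borel) (\<lambda>\<omega>. (\<theta> (Suc m) \<omega>, V (Suc m) \<omega>)))
      borel (\<lambda>w. F (rvec {..m} (mean_chain n \<theta> q Y x) \<omega>, w))" for \<omega>
    unfolding distr_\<theta>_V[OF 1] K_def F_def
    by (auto simp: rvec_apply case_prod_beta intro!: distr_cong)
  moreover have "mean_chain n \<theta> q Y x (Suc m) \<omega> = F (rvec {..m} (mean_chain n \<theta> q Y x) \<omega>, \<theta> (Suc m) \<omega>, V (Suc m) \<omega>)" for \<omega>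
    by (simp add: F_def rvec_apply V_def)
  ultimately show "AE \<omega> in M. real_cond_exp M (generated_by M (rvec {..m} (mean_chain n \<theta> q Y x)) (PiM {..m} (\<lambda>_. borel)))
      (\<lambda>\<omega>. indicator A (mean_chain n \<theta> q Y x (Suc m) \<omega>)) \<omega> = measure (K (mean_chain n \<theta> q Y x m \<omega>)) A"
    using real_cond_exp_generated_by_indep[OF indep_past_\<theta>_V F A, of x] by simp
qed

end

section \<open>Dirichlet weights, supports and Polya sequences\<close>

text \<open>With parameter 1 the Gamma variables are exponential, hence almost surely positive. Then
  so is their sum, and the normalisation does not divide by zero.\<close>

lemma AE_dirichlet_one_simplex:
  assumes I: "finite I" "I \<noteq> {}"
  shows "AE z in dirichlet I (\<lambda>_. 1). (\<forall>i\<in>I. 0 \<le> z i) \<and> (\<Sum>i\<in>I. z i) = (1::real)"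
proof -
  define D where "D = density lborel (\<lambda>x. ennreal (gamma_density 1 x))"
  have D_eq: "D = density lborel (exponential_density 1)"
    unfolding D_def
  proof (rule density_cong)
    show "AE x in lborel. ennreal (gamma_density 1 x) = ennreal (exponential_density 1 x)"
      using AE_lborel_singleton[of 0]
      by eventually_elim (auto simp: gamma_density_def exponential_density_def)
    show "(\<lambda>x. ennreal (gamma_density 1 x)) \<in> borel_measurable lborel"
      unfolding gamma_density_def by measurable
  qed measurable
  have prob_D: "prob_space D"
    unfolding D_eq by (rule prob_space_exponential_density) simp
  have pos: "AE x in D. 0 < x"
    unfolding D_def by (subst AE_density) (auto simp: gamma_density_def)
  have sets_PiM_D: "sets (PiM I (\<lambda>_. D)) = sets (PiM I (\<lambda>_. borel))"
    by (rule sets_PiM_cong) (simp_all add: D_def)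
  have "AE z in PiM I (\<lambda>_. D). \<forall>i\<in>I. 0 < z i"
    using I(1) pos prob_D by (intro AE_finite_allI AE_PiM_component) auto
  then have AE: "AE z in PiM I (\<lambda>_. D). (\<forall>i\<in>I. 0 \<le> (\<lambda>i\<in>I. z i / (\<Sum>j\<in>I. z j)) i) \<and>
      (\<Sum>i\<in>I. (\<lambda>i\<in>I. z i / (\<Sum>j\<in>I. z j)) i) = 1"
  proof eventually_elim
    case (elim z)
    then have "0 < (\<Sum>j\<in>I. z j)" using I by (intro sum_pos) auto
    then show ?case using elim by (auto simp: sum_divide_distrib[symmetric] less_imp_le)
  qed
  have "(\<lambda>z. \<lambda>i\<in>I. z i / (\<Sum>j\<in>I. z j)) \<in> PiM I (\<lambda>_. borel :: real measure) \<rightarrow>\<^sub>M PiM I (\<lambda>_. borel)"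
    by (intro measurable_restrict borel_measurable_divide borel_measurable_sum measurable_component_singleton)
  then have meas: "(\<lambda>z. \<lambda>i\<in>I. z i / (\<Sum>j\<in>I. z j)) \<in> PiM I (\<lambda>_. D) \<rightarrow>\<^sub>M PiM I (\<lambda>_. borel)"
    using measurable_cong_sets[OF sets_PiM_D refl] by blast
  have set: "{z \<in> space (PiM I (\<lambda>_. borel :: real measure)). (\<forall>i\<in>I. 0 \<le> z i) \<and> (\<Sum>i\<in>I. z i) = 1} \<in> sets (PiM I (\<lambda>_. borel))"
    using I(1) by measurable
  show ?thesis
    unfolding dirichlet_def D_def[symmetric]
    by (subst AE_distr_iff[OF meas set]) (rule AE)
qed

lemma AE_msupport:
  fixes \<mu> :: "'a::second_countable_topology measure"
  assumes sets: "sets \<mu> = sets borel"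
  shows "AE x in \<mu>. x \<in> msupport \<mu>"
proof -
  obtain B :: "'a set set" where B: "countable B" "topological_basis B"
    using ex_countable_basis by blast
  define B0 where "B0 = {U \<in> B. emeasure \<mu> U = 0}"
  have "countable B0" using B(1) by (simp add: B0_def)
  moreover have "U \<in> null_sets \<mu>" if "U \<in> B0" for U
    using that topological_basis_open[OF B(2)] sets by (auto simp: B0_def null_sets_def)
  ultimately have null: "\<Union>B0 \<in> null_sets \<mu>" by (rule null_sets_UN'[where N="\<lambda>x. x", simplified])
  have "{x \<in> space \<mu>. x \<notin> msupport \<mu>} \<subseteq> \<Union>B0"
  proof
    fix x assume "x \<in> {x \<in> space \<mu>. x \<notin> msupport \<mu>}"
    then obtain U where U: "open U" "x \<in> U" "emeasure \<mu> U = 0"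
      by (auto simp: msupport_def zero_less_iff_neq_zero)
    from topological_basisE[OF B(2) U(1,2)] obtain W where W: "W \<in> B" "x \<in> W" "W \<subseteq> U" by blast
    have "emeasure \<mu> W \<le> emeasure \<mu> U" using W U sets by (intro emeasure_mono) auto
    then show "x \<in> \<Union>B0" using W U by (auto simp: B0_def)
  qed
  then show "AE x in \<mu>. x \<in> msupport \<mu>" by (rule AE_I'[OF null])
qed

locale polya_model =
  fixes \<alpha> :: "real measure" and a :: real and N :: "'p measure" and Z :: "nat \<Rightarrow> 'p \<Rightarrow> real"
  assumes finite_\<alpha>: "finite_measure \<alpha>" and sets_\<alpha>: "sets \<alpha> = sets borel"
    and a: "a = measure \<alpha> UNIV" "0 < a"
    and polya: "polya_sequence \<alpha> N Z"
begin

declare One_nat_def [simp del]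

sublocale N: prob_space N
  using polya by (simp add: polya_sequence_def)

lemma measurable_Z[measurable]: "1 \<le> j \<Longrightarrow> Z j \<in> borel_measurable N"
  using polya by (simp add: polya_sequence_def)

lemma measurable_rvec_Z: "rvec {1..j} Z \<in> N \<rightarrow>\<^sub>M PiM {1..j} (\<lambda>_. borel)"
  unfolding rvec_def by (intro measurable_restrict) auto

lemma polya_step:
  assumes j: "1 \<le> j" and C: "C \<in> sets (PiM {1..j} (\<lambda>_. borel))" and A[measurable]: "A \<in> sets borel"
  shows "N.prob {\<omega> \<in> space N. rvec {1..j} Z \<omega> \<in> C \<and> Z (Suc j) \<omega> \<in> A}
    = (\<integral>\<omega>. indicator C (rvec {1..j} Z \<omega>) * ((measure \<alpha> A + (\<Sum>i=1..j. indicator A (Z i \<omega>))) / (a + real j)) \<partial>N)"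
proof -
  note [measurable] = C measurable_rvec_Z[of j] measurable_Z[of "Suc j", simplified]
  interpret F: finite_measure_subalgebra N "generated_by N (rvec {1..j} Z) (PiM {1..j} (\<lambda>_. borel))"
    by unfold_locales (rule subalgebra_generated_by[OF measurable_rvec_Z])
  let ?F = "generated_by N (rvec {1..j} Z) (PiM {1..j} (\<lambda>_. borel))"
  let ?B = "rvec {1..j} Z -` C \<inter> space N"
  have B: "?B \<in> sets ?F"
    using C by (auto simp: sets_generated_by[OF measurable_rvec_Z])
  have int: "integrable N (\<lambda>\<omega>. indicator A (Z (Suc j) \<omega>) :: real)"
    by (rule N.integrable_const_bound[where B=1]) (auto intro!: AE_I2 simp: indicator_def)
  have ce: "AE \<omega> in N. real_cond_exp N ?F (\<lambda>\<omega>. indicator A (Z (Suc j) \<omega>)) \<omega>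
      = (measure \<alpha> A + (\<Sum>i=1..j. indicator A (Z i \<omega>))) / (a + real j)"
    using polya j A unfolding polya_sequence_def a(1) by (auto simp: add_divide_distrib)
  have "N.prob {\<omega> \<in> space N. rvec {1..j} Z \<omega> \<in> C \<and> Z (Suc j) \<omega> \<in> A}
      = (\<integral>\<omega>. indicator {\<omega> \<in> space N. rvec {1..j} Z \<omega> \<in> C \<and> Z (Suc j) \<omega> \<in> A} \<omega> \<partial>N)"
    by simp
  also have "\<dots> = (\<integral>\<omega>\<in>?B. indicator A (Z (Suc j) \<omega>) \<partial>N)"
    unfolding set_lebesgue_integral_def by (intro Bochner_Integration.integral_cong) (auto simp: indicator_def)
  also have "\<dots> = (\<integral>\<omega>\<in>?B. real_cond_exp N ?F (\<lambda>\<omega>. indicator A (Z (Suc j) \<omega>)) \<omega> \<partial>N)"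
    by (rule F.real_cond_exp_intA[OF int B])
  also have "\<dots> = (\<integral>\<omega>. indicator C (rvec {1..j} Z \<omega>) * ((measure \<alpha> A + (\<Sum>i=1..j. indicator A (Z i \<omega>))) / (a + real j)) \<partial>N)"
    unfolding set_lebesgue_integral_def
  proof (rule integral_cong_AE)
    have Zi: "Z i \<in> borel_measurable N" if "i \<in> {1..j}" for i using that by (intro measurable_Z) auto
    have [measurable]: "(\<lambda>\<omega>. \<Sum>i=1..j. indicator A (Z i \<omega>) :: real) \<in> borel_measurable N"
      by (intro borel_measurable_sum measurable_compose[OF Zi borel_measurable_indicator] A) auto
    show "(\<lambda>\<omega>. indicator C (rvec {1..j} Z \<omega>) * ((measure \<alpha> A + (\<Sum>i=1..j. indicator A (Z i \<omega>))) / (a + real j))) \<in> borel_measurable N"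
      by measurable
    show "AE \<omega> in N. indicator ?B \<omega> *\<^sub>R real_cond_exp N ?F (\<lambda>\<omega>. indicator A (Z (Suc j) \<omega>)) \<omega>
        = indicator C (rvec {1..j} Z \<omega>) * ((measure \<alpha> A + (\<Sum>i=1..j. indicator A (Z i \<omega>))) / (a + real j))"
      using ce AE_space by eventually_elim (simp add: indicator_def)
  qed measurable
  finally show ?thesis .
qed

lemma integrable_indicator_Z:
  "1 \<le> j \<Longrightarrow> A \<in> sets borel \<Longrightarrow> integrable N (\<lambda>\<omega>. indicator A (Z j \<omega>) :: real)"
  by (rule N.integrable_const_bound[where B=1]) (auto intro!: AE_I2 simp: indicator_def)

lemma expectation_indicator_Z:
  assumes "1 \<le> j" and A[measurable]: "A \<in> sets borel"
  shows "(\<integral>\<omega>. indicator A (Z j \<omega>) \<partial>N) = N.prob {\<omega> \<in> space N. Z j \<omega> \<in> A}"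
proof -
  note [measurable] = measurable_Z[OF assms(1)]
  have "(\<integral>\<omega>. indicator A (Z j \<omega>) \<partial>N) = (\<integral>\<omega>. indicator {\<omega> \<in> space N. Z j \<omega> \<in> A} \<omega> \<partial>N :: real)"
    by (intro Bochner_Integration.integral_cong) (auto simp: indicator_def)
  then show ?thesis by simp
qed

lemma prob_Z_1: "A \<in> sets borel \<Longrightarrow> N.prob {\<omega> \<in> space N. Z 1 \<omega> \<in> A} = measure \<alpha> A / a"
proof -
  assume A: "A \<in> sets borel"
  have "measure (distr N borel (Z 1)) A = measure \<alpha> A / a"
    using polya A by (simp add: polya_sequence_def a)
  then show ?thesis
    using A by (simp add: measure_distr vimage_def Int_def conj_commute)
qed

lemma prob_Z:
  assumes "1 \<le> j" and A: "A \<in> sets borel"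
  shows "N.prob {\<omega> \<in> space N. Z j \<omega> \<in> A} = measure \<alpha> A / a"
  using assms(1)
proof (induction j rule: less_induct)
  case (less j)
  show ?case
  proof (cases "j = 1")
    case True
    then show ?thesis using prob_Z_1[OF A] by simp
  next
    case False
    then obtain k where k: "j = Suc k" "1 \<le> k" using less.prems by (cases j) auto
    have C: "space (PiM {1..k} (\<lambda>_. borel :: real measure)) \<in> sets (PiM {1..k} (\<lambda>_. borel))" by simp
    have "N.prob {\<omega> \<in> space N. Z j \<omega> \<in> A}
        = N.prob {\<omega> \<in> space N. rvec {1..k} Z \<omega> \<in> space (PiM {1..k} (\<lambda>_. borel)) \<and> Z (Suc k) \<omega> \<in> A}"
      using measurable_space[OF measurable_rvec_Z] k by (intro arg_cong[where f=N.prob]) auto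
    also have "\<dots> = (\<integral>\<omega>. (measure \<alpha> A + (\<Sum>i=1..k. indicator A (Z i \<omega>))) / (a + real k) \<partial>N)"
      unfolding polya_step[OF k(2) C A] using measurable_space[OF measurable_rvec_Z]
      by (intro Bochner_Integration.integral_cong) auto
    also have "\<dots> = (measure \<alpha> A + (\<Sum>i=1..k. measure \<alpha> A / a)) / (a + real k)"
    proof -
      have "(\<integral>\<omega>. (\<Sum>i=1..k. indicator A (Z i \<omega>)) \<partial>N) = (\<Sum>i=1..k. measure \<alpha> A / a)"
        using less.IH k A
        by (subst Bochner_Integration.integral_sum) (auto simp: integrable_indicator_Z expectation_indicator_Z intro!: sum.cong)
      moreover have "integrable N (\<lambda>\<omega>. (\<Sum>i=1..k. indicator A (Z i \<omega>)) :: real)"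
        using A by (intro Bochner_Integration.integrable_sum integrable_indicator_Z) auto
      ultimately show ?thesis by (simp add: N.prob_space)
    qed
    also have "\<dots> = measure \<alpha> A / a"
    proof -
      have "(measure \<alpha> A + real k * (measure \<alpha> A / a)) = (measure \<alpha> A / a) * (a + real k)"
        using a(2) by (simp add: field_simps)
      then show ?thesis using a(2) by simp
    qed
    finally show ?thesis .
  qed
qed

lemma prob_all_Z_pos:
  assumes "1 \<le> j" and A: "A \<in> sets borel" and pos: "0 < measure \<alpha> A"
  shows "0 < N.prob {\<omega> \<in> space N. \<forall>i\<in>{1..j}. Z i \<omega> \<in> A}"
  using assms(1)
proof (induction j rule: dec_induct)
  case base
  then show ?case using prob_Z_1[OF A] pos a(2) by simp
next
  case (step j)
  define C where "C = {z \<in> space (PiM {1..j} (\<lambda>_. borel :: real measure)). \<forall>i\<in>{1..j}. z i \<in> A}"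
  have C: "C \<in> sets (PiM {1..j} (\<lambda>_. borel))"
    unfolding C_def using A by measurable
  note [measurable] = C measurable_rvec_Z[of j] A
  have rv: "indicator C (rvec {1..j} Z \<omega>) = (indicator {\<omega> \<in> space N. \<forall>i\<in>{1..j}. Z i \<omega> \<in> A} \<omega> :: real)"
    if "\<omega> \<in> space N" for \<omega>
    using that measurable_space[OF measurable_rvec_Z that, of j] by (auto simp: indicator_def C_def rvec_apply)
  have bnd: "\<bar>(measure \<alpha> A + (\<Sum>i=1..j. indicator A (Z i \<omega>))) / (a + real j)\<bar> \<le> (measure \<alpha> A + real j) / (a + real j)" for \<omega>
  proof -
    have "0 \<le> (\<Sum>i=1..j. indicator A (Z i \<omega>) :: real)" "(\<Sum>i=1..j. indicator A (Z i \<omega>)) \<le> (\<Sum>i=1..j. 1 :: real)"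
      by (intro sum_nonneg sum_mono; simp add: indicator_def)+
    then show ?thesis using a(2) by (auto intro!: divide_right_mono)
  qed
  have Zi: "Z i \<in> borel_measurable N" if "i \<in> {1..j}" for i using that by (intro measurable_Z) auto
  have [measurable]: "(\<lambda>\<omega>. \<Sum>i=1..j. indicator A (Z i \<omega>) :: real) \<in> borel_measurable N"
    by (intro borel_measurable_sum measurable_compose[OF Zi borel_measurable_indicator] A) auto
  have "0 < measure \<alpha> A / (a + real j) * N.prob {\<omega> \<in> space N. \<forall>i\<in>{1..j}. Z i \<omega> \<in> A}"
    using step pos a(2) by (intro mult_pos_pos divide_pos_pos) auto
  also have "\<dots> = (\<integral>\<omega>. indicator C (rvec {1..j} Z \<omega>) * (measure \<alpha> A / (a + real j)) \<partial>N)"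
  proof -
    have "(\<integral>\<omega>. indicator C (rvec {1..j} Z \<omega>) * (measure \<alpha> A / (a + real j)) \<partial>N)
        = (\<integral>\<omega>. indicator {\<omega> \<in> space N. \<forall>i\<in>{1..j}. Z i \<omega> \<in> A} \<omega> * (measure \<alpha> A / (a + real j)) \<partial>N)"
      by (intro Bochner_Integration.integral_cong) (auto simp: rv)
    then show ?thesis by (auto simp: mult.commute)
  qed
  also have "\<dots> \<le> (\<integral>\<omega>. indicator C (rvec {1..j} Z \<omega>) * ((measure \<alpha> A + (\<Sum>i=1..j. indicator A (Z i \<omega>))) / (a + real j)) \<partial>N)"
  proof (rule integral_mono)
    show "integrable N (\<lambda>\<omega>. indicator C (rvec {1..j} Z \<omega>) * (measure \<alpha> A / (a + real j)))"
      by (rule N.integrable_const_bound[where B="measure \<alpha> A / (a + real j)"])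
        (use a(2) in \<open>auto intro!: AE_I2 simp: indicator_def\<close>)
    show "integrable N (\<lambda>\<omega>. indicator C (rvec {1..j} Z \<omega>) * ((measure \<alpha> A + (\<Sum>i=1..j. indicator A (Z i \<omega>))) / (a + real j)))"
    proof (rule N.integrable_const_bound[where B="(measure \<alpha> A + real j) / (a + real j)"])
      show "AE \<omega> in N. norm (indicator C (rvec {1..j} Z \<omega>) * ((measure \<alpha> A + (\<Sum>i=1..j. indicator A (Z i \<omega>))) / (a + real j)))
          \<le> (measure \<alpha> A + real j) / (a + real j)"
        using bnd a(2) by (auto intro!: AE_I2 divide_nonneg_pos simp: indicator_def)
    qed measurable
    show "indicator C (rvec {1..j} Z \<omega>) * (measure \<alpha> A / (a + real j))
        \<le> indicator C (rvec {1..j} Z \<omega>) * ((measure \<alpha> A + (\<Sum>i=1..j. indicator A (Z i \<omega>))) / (a + real j))" for \<omega>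
      using a(2) by (intro mult_left_mono divide_right_mono) (auto intro!: sum_nonneg)
  qed
  also have "\<dots> = N.prob {\<omega> \<in> space N. rvec {1..j} Z \<omega> \<in> C \<and> Z (Suc j) \<omega> \<in> A}"
    using step by (intro polya_step[OF _ C A, symmetric]) simp
  also have "{\<omega> \<in> space N. rvec {1..j} Z \<omega> \<in> C \<and> Z (Suc j) \<omega> \<in> A} = {\<omega> \<in> space N. \<forall>i\<in>{1..Suc j}. Z i \<omega> \<in> A}"
  proof -
    have "{1..Suc j} = insert (Suc j) {1..j}" by auto
    then show ?thesis
      using measurable_space[OF measurable_rvec_Z, of _ j] by (auto simp: C_def rvec_apply)
  qed
  finally show ?case .
qed

end

section \<open>The chain of weighted Polya means\<close>

lemma convex_real_in_sets_borel:
  fixes E :: "real set"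
  assumes "convex E"
  shows "E \<in> sets borel"
proof -
  have "\<exists>a b. E = {} \<or> E = UNIV \<or> E = {..<b} \<or> E = {..b} \<or> E = {a<..} \<or> E = {a..} \<or>
      E = {a<..<b} \<or> E = {a<..b} \<or> E = {a..<b} \<or> E = {a..b}"
    using assms by (intro interval_cases) (metis is_interval_1 is_interval_convex_1)
  then show ?thesis by auto
qed

locale polya_mean_chain =
  mean_chain_model M n \<theta> q Y T Q P + polya_model \<alpha> a N Z
  for M :: "'w measure" and n \<theta> q Y T Q P and \<alpha> a and N :: "'p measure" and Z +
  assumes T_eq: "T = density lborel (\<lambda>x. ennreal (beta_density (real n) a x))"
    and Q_eq: "Q = dirichlet {1..n} (\<lambda>_. 1)"
    and P_eq: "P = distr N (PiM {1..n} (\<lambda>_. borel)) (rvec {1..n} Z)"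
begin

declare One_nat_def [simp del]

lemma borel_measurable_beta_density: "(\<lambda>x. ennreal (beta_density (real n) a x)) \<in> borel_measurable borel"
  unfolding beta_density_def by measurable

lemma AE_T: "AE t in T. 0 < t \<and> t < 1"
  unfolding T_eq using borel_measurable_beta_density
  by (subst AE_density) (auto simp: beta_density_def)

lemma AE_\<theta>: "1 \<le> m \<Longrightarrow> AE \<omega> in M. 0 < \<theta> m \<omega> \<and> \<theta> m \<omega> < 1"
  by (rule AE_distrD[OF measurable_\<theta>]) (use AE_T law_\<theta> in auto)

lemma AE_q:
  assumes m: "1 \<le> m"
  shows "AE \<omega> in M. (\<forall>i\<in>{1..n}. 0 \<le> q m i \<omega>) \<and> (\<Sum>i=1..n. q m i \<omega>) = 1"
proof -
  have "AE z in distr M R (rvec {1..n} (q m)). (\<forall>i\<in>{1..n}. 0 \<le> z i) \<and> (\<Sum>i\<in>{1..n}. z i) = 1"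
    unfolding law_q[OF m] Q_eq by (rule AE_dirichlet_one_simplex) (use one_in in auto)
  from AE_distrD[OF measurable_rvec_q[OF m] this] show ?thesis
    by (simp add: rvec_apply)
qed

lemma measurable_Y: "1 \<le> m \<Longrightarrow> i \<in> {1..n} \<Longrightarrow> Y m i \<in> borel_measurable M"
proof -
  assume m: "1 \<le> m" and i: "i \<in> {1..n}"
  have "(\<lambda>\<omega>. rvec {1..n} (Y m) \<omega> i) \<in> borel_measurable M"
    by (rule measurable_compose[OF measurable_rvec_Y[OF m] measurable_component_singleton[OF i]])
  then show ?thesis using i by (simp add: rvec_apply)
qed

lemma prob_Y_Z:
  assumes m: "1 \<le> m" and C: "{z \<in> space R. Pr z} \<in> sets R"
  shows "prob {\<omega> \<in> space M. Pr (rvec {1..n} (Y m) \<omega>)} = N.prob {\<omega> \<in> space N. Pr (rvec {1..n} Z \<omega>)}"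
proof -
  have "measure (distr M R (rvec {1..n} (Y m))) {z \<in> space R. Pr z}
      = measure (distr N R (rvec {1..n} Z)) {z \<in> space R. Pr z}"
    unfolding law_Y[OF m] P_eq ..
  also have "measure (distr M R (rvec {1..n} (Y m))) {z \<in> space R. Pr z}
      = prob {\<omega> \<in> space M. Pr (rvec {1..n} (Y m) \<omega>)}"
    unfolding measure_distr[OF measurable_rvec_Y[OF m] C]
    using measurable_space[OF measurable_rvec_Y[OF m]] by (intro arg_cong[where f=prob]) auto
  also have "measure (distr N R (rvec {1..n} Z)) {z \<in> space R. Pr z}
      = N.prob {\<omega> \<in> space N. Pr (rvec {1..n} Z \<omega>)}"
    unfolding measure_distr[OF measurable_rvec_Z C]
    using measurable_space[OF measurable_rvec_Z] by (intro arg_cong[where f=N.prob]) auto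
  finally show ?thesis .
qed

lemma prob_Y:
  assumes m: "1 \<le> m" and i: "i \<in> {1..n}" and A[measurable]: "A \<in> sets borel"
  shows "prob {\<omega> \<in> space M. Y m i \<omega> \<in> A} = measure \<alpha> A / a"
proof -
  have "{z \<in> space R. z i \<in> A} \<in> sets R" using i by measurable
  from prob_Y_Z[OF m this] show ?thesis
    using prob_Z[OF _ A, of i] i by (simp add: rvec_apply)
qed

lemma distr_Y:
  assumes m: "1 \<le> m" and i: "i \<in> {1..n}"
  shows "distr M borel (Y m i) = scale_measure (ennreal (1 / a)) \<alpha>"
proof (rule measure_eqI)
  interpret \<alpha>: finite_measure \<alpha> by (rule finite_\<alpha>)
  fix A assume "A \<in> sets (distr M borel (Y m i))"
  then have A: "A \<in> sets borel" by simp
  have "emeasure (distr M borel (Y m i)) A = ennreal (prob {\<omega> \<in> space M. Y m i \<omega> \<in> A})"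
    using A measurable_Y[OF m i]
    by (simp add: emeasure_distr emeasure_eq_measure vimage_def Int_def conj_commute)
  also have "\<dots> = ennreal (1 / a) * ennreal (measure \<alpha> A)"
    unfolding prob_Y[OF m i A] using a(2) by (simp add: ennreal_mult'[symmetric])
  also have "\<dots> = emeasure (scale_measure (ennreal (1 / a)) \<alpha>) A"
    by (simp add: \<alpha>.emeasure_eq_measure)
  finally show "emeasure (distr M borel (Y m i)) A = emeasure (scale_measure (ennreal (1 / a)) \<alpha>) A" .
qed (simp add: sets_\<alpha>)

lemma nn_integral_Y:
  assumes "1 \<le> m" "i \<in> {1..n}"
  shows "(\<integral>\<^sup>+\<omega>. ennreal \<bar>Y m i \<omega>\<bar> \<partial>M) = (\<integral>\<^sup>+x. ennreal \<bar>x\<bar> \<partial>scale_measure (ennreal (1 / a)) \<alpha>)"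
  unfolding distr_Y[OF assms, symmetric] using measurable_Y[OF assms]
  by (subst nn_integral_distr) auto

lemma AE_Y:
  assumes m: "1 \<le> m" and i: "i \<in> {1..n}" and A: "A \<in> sets borel" and AE: "AE x in \<alpha>. x \<in> A"
  shows "AE \<omega> in M. Y m i \<omega> \<in> A"
proof -
  interpret \<alpha>: finite_measure \<alpha> by (rule finite_\<alpha>)
  have sp: "space \<alpha> = UNIV" using sets_eq_imp_space_eq[OF sets_\<alpha>] by simp
  have "measure \<alpha> A = measure \<alpha> UNIV"
    by (rule \<alpha>.finite_measure_eq_AE) (use AE A sets_\<alpha> in auto)
  then have "prob {\<omega> \<in> space M. Y m i \<omega> \<in> A} = 1"
    using prob_Y[OF m i A] a by simp
  moreover have "{\<omega> \<in> space M. Y m i \<omega> \<in> A} \<in> events"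
    using measurable_Y[OF m i] A by measurable
  ultimately show ?thesis using prob_Collect_eq_1[of "\<lambda>\<omega>. Y m i \<omega> \<in> A"] by simp
qed

lemma V_in_convex:
  assumes "convex E" "\<forall>i\<in>{1..n}. Y m i \<omega> \<in> E"
    and "(\<forall>i\<in>{1..n}. 0 \<le> q m i \<omega>) \<and> (\<Sum>i=1..n. q m i \<omega>) = 1"
  shows "V m \<omega> \<in> E"
  using convex_sum[of "{1..n}" E "\<lambda>i. q m i \<omega>" "\<lambda>i. Y m i \<omega>"] assms by (simp add: V_def)

lemma AE_V:
  assumes m: "1 \<le> m" and E: "convex E" and AE: "AE x in \<alpha>. x \<in> E"
  shows "AE \<omega> in M. V m \<omega> \<in> E"
proof -
  have "AE \<omega> in M. \<forall>i\<in>{1..n}. Y m i \<omega> \<in> E"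
    using AE_Y[OF m _ convex_real_in_sets_borel[OF E] AE] by (intro AE_finite_allI) auto
  then show ?thesis using AE_q[OF m] by eventually_elim (rule V_in_convex[OF E])
qed

lemma measure_law_V_pos:
  assumes E: "convex E" and pos: "0 < measure \<alpha> E"
  shows "0 < measure law_V E"
proof -
  have E'[measurable]: "E \<in> sets borel" by (rule convex_real_in_sets_borel[OF E])
  have C: "{z \<in> space R. \<forall>i\<in>{1..n}. z i \<in> E} \<in> sets R" by measurable
  have "0 < N.prob {\<omega> \<in> space N. \<forall>i\<in>{1..n}. Z i \<omega> \<in> E}"
    by (rule prob_all_Z_pos[OF n E' pos])
  also have "\<dots> = prob {\<omega> \<in> space M. \<forall>i\<in>{1..n}. Y 1 i \<omega> \<in> E}"
    using prob_Y_Z[OF order_refl C] by (simp add: rvec_apply)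
  also have "\<dots> \<le> prob {\<omega> \<in> space M. V 1 \<omega> \<in> E}"
  proof (rule finite_measure_mono_AE)
    show "AE \<omega> in M. \<omega> \<in> {\<omega> \<in> space M. \<forall>i\<in>{1..n}. Y 1 i \<omega> \<in> E} \<longrightarrow> \<omega> \<in> {\<omega> \<in> space M. V 1 \<omega> \<in> E}"
      using AE_q[OF order_refl] by eventually_elim (auto intro: V_in_convex[OF E])
    show "{\<omega> \<in> space M. V 1 \<omega> \<in> E} \<in> events"
      using measurable_V[OF order_refl] by measurable
  qed
  also have "\<dots> = measure law_V E"
    unfolding distr_V[OF order_refl, symmetric] using measurable_V[OF order_refl]
    by (simp add: measure_distr vimage_def Int_def conj_commute)
  finally show ?thesis .
qed

lemma nn_integral_law_V_le:
  "(\<integral>\<^sup>+v. ennreal \<bar>v\<bar> \<partial>law_V) \<le> of_nat n * (\<integral>\<^sup>+x. ennreal \<bar>x\<bar> \<partial>scale_measure (ennreal (1 / a)) \<alpha>)"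
proof -
  have [measurable]: "Y 1 i \<in> borel_measurable M" if "i \<in> {1..n}" for i
    using that by (rule measurable_Y[OF order_refl])
  have "(\<integral>\<^sup>+v. ennreal \<bar>v\<bar> \<partial>law_V) = (\<integral>\<^sup>+\<omega>. ennreal \<bar>V 1 \<omega>\<bar> \<partial>M)"
    unfolding distr_V[OF order_refl, symmetric] using measurable_V[OF order_refl]
    by (subst nn_integral_distr) auto
  also have "\<dots> \<le> (\<integral>\<^sup>+\<omega>. (\<Sum>i=1..n. ennreal \<bar>Y 1 i \<omega>\<bar>) \<partial>M)"
  proof (rule nn_integral_mono_AE)
    show "AE \<omega> in M. ennreal \<bar>V 1 \<omega>\<bar> \<le> (\<Sum>i=1..n. ennreal \<bar>Y 1 i \<omega>\<bar>)"
      using AE_q[OF order_refl]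
    proof eventually_elim
      case (elim \<omega>)
      have q1: "\<bar>q 1 i \<omega>\<bar> \<le> 1" if "i \<in> {1..n}" for i
        using elim that member_le_sum[of i "{1..n}" "\<lambda>i. q 1 i \<omega>"] by auto
      have "\<bar>V 1 \<omega>\<bar> \<le> (\<Sum>i=1..n. \<bar>q 1 i \<omega> * Y 1 i \<omega>\<bar>)"
        unfolding V_def by (rule sum_abs)
      also have "\<dots> \<le> (\<Sum>i=1..n. \<bar>Y 1 i \<omega>\<bar>)"
        using q1 by (intro sum_mono) (simp add: abs_mult mult_left_le_one_le)
      finally show ?case by (simp add: sum_ennreal ennreal_leI)
    qed
  qed
  also have "\<dots> = (\<Sum>i=1..n. (\<integral>\<^sup>+\<omega>. ennreal \<bar>Y 1 i \<omega>\<bar> \<partial>M))"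
    by (rule nn_integral_sum) measurable
  also have "\<dots> = (\<Sum>i=1..n. (\<integral>\<^sup>+x. ennreal \<bar>x\<bar> \<partial>scale_measure (ennreal (1 / a)) \<alpha>))"
    by (rule sum.cong) (simp_all add: nn_integral_Y)
  finally show ?thesis by simp
qed

lemma K_eq_distr: "K x = distr M borel (\<lambda>\<omega>. \<theta> 1 \<omega> * V 1 \<omega> + (1 - \<theta> 1 \<omega>) * x)"
proof -
  have "mean_chain n \<theta> q Y x 1 = (\<lambda>\<omega>. \<theta> 1 \<omega> * V 1 \<omega> + (1 - \<theta> 1 \<omega>) * x)"
    by (simp add: fun_eq_iff One_nat_def V_def)
  then show ?thesis unfolding mean_kernel_eq[symmetric] mean_kernel_def by simp
qed

lemma measurable_step[measurable]: "(\<lambda>\<omega>. \<theta> 1 \<omega> * V 1 \<omega> + (1 - \<theta> 1 \<omega>) * x) \<in> borel_measurable M"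
  using measurable_\<theta>[of 1] measurable_V[of 1] by simp

lemma measure_K: "A \<in> sets borel \<Longrightarrow>
    measure (K x) A = prob {\<omega> \<in> space M. \<theta> 1 \<omega> * V 1 \<omega> + (1 - \<theta> 1 \<omega>) * x \<in> A}"
  unfolding K_eq_distr by (simp add: measure_distr vimage_def Int_def conj_commute)

lemma stochastically_monotone_K: "stochastically_monotone K"
  unfolding stochastically_monotone_def
proof (intro allI impI)
  fix z1 z2 s :: real assume z: "z1 < z2"
  have "AE \<omega> in M. \<theta> 1 \<omega> * V 1 \<omega> + (1 - \<theta> 1 \<omega>) * z1 \<le> \<theta> 1 \<omega> * V 1 \<omega> + (1 - \<theta> 1 \<omega>) * z2"
    using AE_\<theta>[OF order_refl] by eventually_elim (use z in \<open>auto intro!: mult_left_mono\<close>)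
  then have "AE \<omega> in M. \<omega> \<in> {\<omega> \<in> space M. \<theta> 1 \<omega> * V 1 \<omega> + (1 - \<theta> 1 \<omega>) * z2 \<in> {..<s}} \<longrightarrow>
      \<omega> \<in> {\<omega> \<in> space M. \<theta> 1 \<omega> * V 1 \<omega> + (1 - \<theta> 1 \<omega>) * z1 \<in> {..<s}}"
    by eventually_elim auto
  then show "measure (K z1) {..<s} \<ge> measure (K z2) {..<s}"
    by (subst (1 2) measure_K) (auto intro!: finite_measure_mono_AE)
qed

lemma absorbing_convex:
  assumes E: "convex E" and AE: "AE x in \<alpha>. x \<in> E"
  shows "absorbing borel K E"
  unfolding absorbing_def
proof (intro conjI ballI)
  show E': "E \<in> sets borel" by (rule convex_real_in_sets_borel[OF E])
  fix x assume x: "x \<in> E"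
  have "AE \<omega> in M. \<theta> 1 \<omega> * V 1 \<omega> + (1 - \<theta> 1 \<omega>) * x \<in> E"
    using AE_\<theta>[OF order_refl] AE_V[OF order_refl E AE]
    by eventually_elim (use convexD[OF E _ x] in auto)
  moreover have "{\<omega> \<in> space M. \<theta> 1 \<omega> * V 1 \<omega> + (1 - \<theta> 1 \<omega>) * x \<in> E} \<in> events"
    using E' by measurable
  ultimately show "measure (K x) E = 1"
    unfolding measure_K[OF E'] using prob_Collect_eq_1[of "\<lambda>\<omega>. \<theta> 1 \<omega> * V 1 \<omega> + (1 - \<theta> 1 \<omega>) * x \<in> E"] by simp
qed

end

lemma beta_density_lower_bound:
  assumes b: "0 < b" and c: "0 < c" and \<eta>: "0 < \<eta>"
  shows "\<exists>\<kappa>>0. \<forall>t. \<eta> \<le> t \<longrightarrow> t \<le> 1 - \<eta> \<longrightarrow> \<kappa> \<le> beta_density b c t"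
proof (intro exI conjI allI impI)
  have powr_ge: "\<eta> powr \<bar>r\<bar> \<le> t powr r" if "\<eta> \<le> t" "t \<le> 1" for t r :: real
  proof (cases "0 \<le> r")
    case True
    then show ?thesis using that \<eta> by (auto intro: powr_mono2)
  next
    case False
    then have "t powr 0 \<le> t powr r" using that \<eta> by (intro powr_mono') auto
    moreover have "\<eta> powr \<bar>r\<bar> \<le> 1" using that \<eta> by (intro powr_le1) auto
    ultimately show ?thesis using that \<eta> by simp
  qed
  have B: "0 < Beta b c" using b c by (simp add: Beta_def Gamma_real_pos)
  show "0 < \<eta> powr \<bar>b - 1\<bar> * \<eta> powr \<bar>c - 1\<bar> / Beta b c" using \<eta> B by simp
  fix t assume t: "\<eta> \<le> t" "t \<le> 1 - \<eta>"
  then have "\<eta> powr \<bar>b - 1\<bar> * \<eta> powr \<bar>c - 1\<bar> \<le> t powr (b - 1) * (1 - t) powr (c - 1)"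
    using \<eta> by (intro mult_mono powr_ge) auto
  then show "\<eta> powr \<bar>b - 1\<bar> * \<eta> powr \<bar>c - 1\<bar> / Beta b c \<le> beta_density b c t"
    using t \<eta> B by (auto simp: beta_density_def divide_right_mono)
qed

context polya_mean_chain
begin

lemma emeasure_K:
  assumes A[measurable]: "A \<in> sets borel"
  shows "emeasure (K x) A = (\<integral>\<^sup>+v. (\<integral>\<^sup>+t. indicator A (t * v + (1 - t) * x) \<partial>T) \<partial>law_V)"
proof -
  interpret T: prob_space T by (rule prob_space_T)
  interpret L: prob_space law_V by (rule prob_space_law_V)
  interpret TL: pair_prob_space T law_V ..
  note [measurable_cong] = sets_T sets_law_V
  have "emeasure (K x) A = (\<integral>\<^sup>+z. indicator A z \<partial>K x)"
    by (simp add: K_def)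
  also have "\<dots> = (\<integral>\<^sup>+z. indicator A (case z of (t, v) \<Rightarrow> t * v + (1 - t) * x) \<partial>(T \<Otimes>\<^sub>M law_V))"
    unfolding K_def by (rule nn_integral_distr) measurable
  also have "\<dots> = (\<integral>\<^sup>+v. (\<integral>\<^sup>+t. indicator A (t * v + (1 - t) * x) \<partial>T) \<partial>law_V)"
    by (subst TL.nn_integral_snd[symmetric]) auto
  finally show ?thesis .
qed

text \<open>For fixed \<open>v\<close> the substitution \<open>z = x + t (v - x)\<close> turns the Beta density into a density of
  the next position, bounded below away from \<open>x\<close> and \<open>v\<close>.\<close>

lemma nn_integral_T_lower_bound:
  assumes [measurable]: "A \<in> sets borel" "G \<in> sets borel"
    and x: "x \<noteq> v" "\<bar>v - x\<bar> \<le> l"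
    and G: "\<And>z. z \<in> G \<Longrightarrow> \<eta> \<le> (z - x) / (v - x) \<and> (z - x) / (v - x) \<le> 1 - \<eta>"
    and \<kappa>: "0 \<le> \<kappa>" "\<And>t. \<eta> \<le> t \<Longrightarrow> t \<le> 1 - \<eta> \<Longrightarrow> \<kappa> \<le> beta_density (real n) a t"
  shows "ennreal (\<kappa> / l) * emeasure lborel (A \<inter> G) \<le> (\<integral>\<^sup>+t. indicator A (t * v + (1 - t) * x) \<partial>T)"
proof -
  note [measurable] = borel_measurable_beta_density
  define h where "h z = ennreal (beta_density (real n) a ((z - x) / (v - x))) * indicator A z * ennreal (1 / \<bar>v - x\<bar>)" for z
  have h[measurable]: "h \<in> borel_measurable borel"
    unfolding h_def using measurable_compose[OF _ borel_measurable_beta_density, of "\<lambda>z. (z - x) / (v - x)" borel]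
    by measurable
  have l: "0 < l" using x by linarith
  have "ennreal (\<kappa> / l) * emeasure lborel (A \<inter> G) = (\<integral>\<^sup>+z. ennreal (\<kappa> / l) * indicator (A \<inter> G) z \<partial>lborel)"
    by (simp add: nn_integral_cmult_indicator)
  also have "\<dots> \<le> (\<integral>\<^sup>+z. h z \<partial>lborel)"
  proof (rule nn_integral_mono)
    fix z
    show "ennreal (\<kappa> / l) * indicator (A \<inter> G) z \<le> h z"
    proof (cases "z \<in> A \<inter> G")
      case True
      then have \<kappa>': "\<kappa> \<le> beta_density (real n) a ((z - x) / (v - x))" using G[of z] by (intro \<kappa>) auto
      then have "\<kappa> / l \<le> beta_density (real n) a ((z - x) / (v - x)) / \<bar>v - x\<bar>"
        using x \<kappa>(1) by (intro frac_le) auto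
      then show ?thesis
        using True x \<kappa>(1) \<kappa>' by (simp add: h_def ennreal_mult'[symmetric] ennreal_leI)
    qed simp
  qed
  also have "\<dots> = ennreal \<bar>v - x\<bar> * (\<integral>\<^sup>+t. h (x + (v - x) * t) \<partial>lborel)"
    using x by (intro nn_integral_real_affine h) simp
  also have "\<dots> = (\<integral>\<^sup>+t. ennreal \<bar>v - x\<bar> * h (x + (v - x) * t) \<partial>lborel)"
    by (intro nn_integral_cmult[symmetric]) measurable
  also have "\<dots> = (\<integral>\<^sup>+t. ennreal (beta_density (real n) a t) * indicator A (t * v + (1 - t) * x) \<partial>lborel)"
  proof (rule nn_integral_cong)
    fix t
    have "x + (v - x) * t = t * v + (1 - t) * x" by (simp add: algebra_simps)
    moreover have "(x + (v - x) * t - x) / (v - x) = t" using x by simp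
    moreover have "ennreal \<bar>v - x\<bar> * (c * ennreal (1 / \<bar>v - x\<bar>)) = c" for c
    proof -
      have "ennreal \<bar>v - x\<bar> * ennreal (1 / \<bar>v - x\<bar>) = 1"
        using x by (subst ennreal_mult[symmetric]) auto
      then show ?thesis by (metis mult.left_commute mult.right_neutral)
    qed
    ultimately show "ennreal \<bar>v - x\<bar> * h (x + (v - x) * t)
        = ennreal (beta_density (real n) a t) * indicator A (t * v + (1 - t) * x)"
      unfolding h_def by metis
  qed
  also have "\<dots> = (\<integral>\<^sup>+t. indicator A (t * v + (1 - t) * x) \<partial>T)"
    unfolding T_eq by (rule nn_integral_density[symmetric]) measurable
  finally show ?thesis .
qed

lemma msupport_two_points:
  assumes "\<not> point_supported \<alpha>"
  obtains u v where "u \<in> msupport \<alpha>" "v \<in> msupport \<alpha>" "u < v"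
proof -
  have ne: "\<not> (AE x in \<alpha>. x = c)" for c
    using assms by (auto simp: point_supported_def)
  have "\<exists>u v. u \<in> msupport \<alpha> \<and> v \<in> msupport \<alpha> \<and> u \<noteq> v"
  proof (rule ccontr)
    assume *: "\<not> (\<exists>u v. u \<in> msupport \<alpha> \<and> v \<in> msupport \<alpha> \<and> u \<noteq> v)"
    have "AE x in \<alpha>. x = (SOME x. x \<in> msupport \<alpha>)"
      by (intro eventually_mono[OF AE_msupport[OF sets_\<alpha>]]) (metis * someI)
    then show False using ne by blast
  qed
  then show ?thesis using that by (metis linorder_less_linear)
qed

text \<open>From \<open>x\<close> the chain reaches every \<open>z\<close> of the gap between two support points: for
  \<open>z > x\<close> it is pulled towards the right one, for \<open>z < x\<close> towards the left one. Points
  \<open>z\<close> close to \<open>x\<close> are lost, so the minorant depends on the pair \<open>x, y\<close>, but not its mass.\<close>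

lemma minorization:
  assumes nd: "\<not> point_supported \<alpha>"
  shows "\<exists>e>0. \<forall>x y. \<bar>x\<bar> \<le> b \<longrightarrow> \<bar>y\<bar> \<le> b \<longrightarrow>
    (\<exists>\<mu>. sets \<mu> = sets borel \<and> ennreal e \<le> emeasure \<mu> UNIV \<and>
      (\<forall>A\<in>sets borel. emeasure \<mu> A \<le> emeasure (K x) A \<and> emeasure \<mu> A \<le> emeasure (K y) A))"
proof -
  interpret \<alpha>: finite_measure \<alpha> by (rule finite_\<alpha>)
  interpret L: prob_space law_V by (rule prob_space_law_V)
  note [measurable_cong] = sets_T sets_law_V
  obtain p p' where p: "p \<in> msupport \<alpha>" "p' \<in> msupport \<alpha>" "p < p'"
    using msupport_two_points[OF nd] by blast
  define \<delta> where "\<delta> = (p' - p) / 21"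
  define c d where "c = p + 7 * \<delta>" and "d = c + 7 * \<delta>"
  have \<delta>: "0 < \<delta>" and "21 * \<delta> = p' - p" using p by (auto simp: \<delta>_def)
  then have cd: "p' = d + 7 * \<delta>" unfolding c_def d_def by linarith
  define B1 B2 where "B1 = {p - 1<..<c}" and "B2 = {d<..<p' + 1}"
  have "0 < measure \<alpha> B1" "0 < measure \<alpha> B2"
  proof -
    have "0 < emeasure \<alpha> B1" "0 < emeasure \<alpha> B2"
      using p \<delta> cd by (auto simp: msupport_def B1_def B2_def c_def)
    then show "0 < measure \<alpha> B1" "0 < measure \<alpha> B2"
      by (simp_all add: \<alpha>.emeasure_eq_measure)
  qed
  then have "0 < measure law_V B1" "0 < measure law_V B2"
    by (auto intro!: measure_law_V_pos simp: B1_def B2_def)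
  then obtain w where w: "0 < w" "w \<le> measure law_V B1" "w \<le> measure law_V B2"
    by (meson linorder_le_cases order_refl)
  define l where "l = \<bar>b\<bar> + \<bar>p\<bar> + \<bar>p'\<bar> + 1"
  have l: "0 < l" by (simp add: l_def add_nonneg_pos)
  define \<eta> where "\<eta> = \<delta> / l"
  have \<eta>: "0 < \<eta>" using \<delta> l by (simp add: \<eta>_def)
  have n0: "0 < real n" using n by simp
  obtain \<kappa> where \<kappa>: "0 < \<kappa>" "\<And>t. \<eta> \<le> t \<Longrightarrow> t \<le> 1 - \<eta> \<Longrightarrow> \<kappa> \<le> beta_density (real n) a t"
    using beta_density_lower_bound[OF n0 a(2) \<eta>] by blast
  define k where "k = \<kappa> / l * w"
  have k: "0 < k" using \<kappa> l w by (simp add: k_def)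
  define S where "S x = {z. c + \<delta> \<le> z \<and> z \<le> d - \<delta> \<and> \<delta> \<le> \<bar>z - x\<bar>}" for x
  have S[measurable]: "S x \<in> sets borel" for x unfolding S_def by measurable
  have lower: "ennreal k * emeasure lborel (A \<inter> S x) \<le> emeasure (K x) A"
    if x: "\<bar>x\<bar> \<le> b" and A[measurable]: "A \<in> sets borel" for x A
  proof -
    let ?I = "\<lambda>v. \<integral>\<^sup>+t. indicator A (t * v + (1 - t) * x) \<partial>T"
    define G1 G2 where "G1 = S x \<inter> {..<x}" and "G2 = S x \<inter> {x<..}"
    have [measurable]: "G1 \<in> sets borel" "G2 \<in> sets borel" by (auto simp: G1_def G2_def)
    have ratio: "\<eta> \<le> r / s \<and> r / s \<le> 1 - \<eta>" if "\<delta> \<le> r" "\<delta> \<le> s - r" "s \<le> l" for r s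
    proof -
      have s: "0 < s" using that \<delta> by linarith
      have "\<eta> \<le> \<delta> / s" unfolding \<eta>_def using that s \<delta> by (intro divide_left_mono) auto
      also have le: "\<delta> / s \<le> r / s" using that s by (intro divide_right_mono) auto
      finally have 1: "\<eta> \<le> r / s" .
      have "\<eta> \<le> \<delta> / s" unfolding \<eta>_def using that s \<delta> by (intro divide_left_mono) auto
      also have "\<delta> / s \<le> (s - r) / s" using that s by (intro divide_right_mono) auto
      also have "\<dots> = 1 - r / s" using s by (simp add: diff_divide_distrib)
      finally show ?thesis using 1 by simp
    qed
    have neg: "(z - x) / (v - x) = (x - z) / (x - v)" for z v
      by (metis minus_diff_eq minus_divide_divide)
    have I1: "ennreal (\<kappa> / l) * emeasure lborel (A \<inter> G1) \<le> ?I v" if v: "v \<in> B1" for v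
    proof (cases "G1 = {}")
      case False
      then have xv: "v < x" using v \<delta> by (auto simp: G1_def S_def B1_def)
      show ?thesis
      proof (rule nn_integral_T_lower_bound[where \<eta>=\<eta>])
        show "\<bar>v - x\<bar> \<le> l" using v x xv cd \<delta> by (auto simp: l_def B1_def c_def)
        show "\<eta> \<le> (z - x) / (v - x) \<and> (z - x) / (v - x) \<le> 1 - \<eta>" if "z \<in> G1" for z
          unfolding neg using that v x xv cd \<delta>
          by (intro ratio) (auto simp: G1_def S_def B1_def l_def c_def)
      qed (use xv \<kappa> in auto)
    qed simp
    have I2: "ennreal (\<kappa> / l) * emeasure lborel (A \<inter> G2) \<le> ?I v" if v: "v \<in> B2" for v
    proof (cases "G2 = {}")
      case False
      then have xv: "x < v" using v \<delta> by (auto simp: G2_def S_def B2_def)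
      show ?thesis
      proof (rule nn_integral_T_lower_bound[where \<eta>=\<eta>])
        show "\<bar>v - x\<bar> \<le> l" using v x xv cd \<delta> by (auto simp: l_def B2_def c_def d_def)
        show "\<eta> \<le> (z - x) / (v - x) \<and> (z - x) / (v - x) \<le> 1 - \<eta>" if "z \<in> G2" for z
          using that v x xv cd \<delta>
          by (intro ratio) (auto simp: G2_def S_def B2_def l_def c_def d_def)
      qed (use xv \<kappa> in auto)
    qed simp
    have "A \<inter> S x = (A \<inter> G1) \<union> (A \<inter> G2)"
      using \<delta> by (auto simp: G1_def G2_def S_def)
    moreover have "(A \<inter> G1) \<inter> (A \<inter> G2) = {}" by (auto simp: G1_def G2_def)
    ultimately have split: "emeasure lborel (A \<inter> S x) = emeasure lborel (A \<inter> G1) + emeasure lborel (A \<inter> G2)"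
      by (simp add: plus_emeasure)
    have k_eq: "ennreal k = ennreal (\<kappa> / l) * ennreal w"
      unfolding k_def using \<kappa> l w by (intro ennreal_mult) auto
    have kw: "ennreal k * m \<le> ennreal (\<kappa> / l) * m * emeasure law_V B"
      if "w \<le> measure law_V B" for m B
    proof -
      have "ennreal k * m = ennreal (\<kappa> / l) * m * ennreal w"
        using \<kappa> l w by (simp only: k_eq ac_simps)
      also have "\<dots> \<le> ennreal (\<kappa> / l) * m * emeasure law_V B"
        using that by (intro mult_left_mono) (auto simp: L.emeasure_eq_measure ennreal_leI)
      finally show ?thesis .
    qed
    have [measurable]: "B1 \<in> sets borel" "B2 \<in> sets borel" by (auto simp: B1_def B2_def)
    have "ennreal k * emeasure lborel (A \<inter> S x)
        \<le> ennreal (\<kappa> / l) * emeasure lborel (A \<inter> G1) * emeasure law_V B1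
          + ennreal (\<kappa> / l) * emeasure lborel (A \<inter> G2) * emeasure law_V B2"
      unfolding split distrib_left by (intro add_mono kw w)
    also have "\<dots> = (\<integral>\<^sup>+v. ennreal (\<kappa> / l) * emeasure lborel (A \<inter> G1) * indicator B1 v
          + ennreal (\<kappa> / l) * emeasure lborel (A \<inter> G2) * indicator B2 v \<partial>law_V)"
      by (subst nn_integral_add) (auto simp: nn_integral_cmult_indicator sets_law_V)
    also have "\<dots> \<le> (\<integral>\<^sup>+v. ?I v \<partial>law_V)"
    proof (rule nn_integral_mono)
      fix v
      have "\<not> (v \<in> B1 \<and> v \<in> B2)" using \<delta> by (auto simp: B1_def B2_def d_def)
      then show "ennreal (\<kappa> / l) * emeasure lborel (A \<inter> G1) * indicator B1 v
          + ennreal (\<kappa> / l) * emeasure lborel (A \<inter> G2) * indicator B2 v \<le> ?I v"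
        using I1[of v] I2[of v] by (auto simp: indicator_def)
    qed
    finally show ?thesis unfolding emeasure_K[OF A] .
  qed
  show ?thesis
  proof (intro exI[of _ "k * \<delta>"] conjI allI impI)
    show "0 < k * \<delta>" using k \<delta> by simp
    fix x y assume xy: "\<bar>x\<bar> \<le> b" "\<bar>y\<bar> \<le> b"
    define \<mu> where "\<mu> = density lborel (\<lambda>z. ennreal k * indicator (S x \<inter> S y) z)"
    have em: "emeasure \<mu> A = ennreal k * emeasure lborel (A \<inter> (S x \<inter> S y))" if "A \<in> sets borel" for A
    proof -
      have "emeasure \<mu> A = (\<integral>\<^sup>+z. ennreal k * indicator (S x \<inter> S y) z * indicator A z \<partial>lborel)"
        unfolding \<mu>_def using that by (intro emeasure_density) auto
      also have "\<dots> = (\<integral>\<^sup>+z. ennreal k * indicator (A \<inter> (S x \<inter> S y)) z \<partial>lborel)"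
        by (intro nn_integral_cong) (auto simp: indicator_def)
      also have "\<dots> = ennreal k * emeasure lborel (A \<inter> (S x \<inter> S y))"
        using that by (intro nn_integral_cmult_indicator) auto
      finally show ?thesis .
    qed
    have "ennreal (5 * \<delta>) = emeasure lborel {c + \<delta>..d - \<delta>}"
      using \<delta> by (simp add: d_def)
    also have "\<dots> \<le> emeasure lborel ((S x \<inter> S y) \<union> ({x - \<delta><..<x + \<delta>} \<union> {y - \<delta><..<y + \<delta>}))"
      by (intro emeasure_mono) (auto simp: S_def)
    also have "\<dots> \<le> emeasure lborel (S x \<inter> S y) + emeasure lborel ({x - \<delta><..<x + \<delta>} \<union> {y - \<delta><..<y + \<delta>})"
      by (rule emeasure_subadditive) auto
    also have "\<dots> \<le> emeasure lborel (S x \<inter> S y) + (emeasure lborel {x - \<delta><..<x + \<delta>} + emeasure lborel {y - \<delta><..<y + \<delta>})"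
      by (intro add_left_mono emeasure_subadditive) auto
    also have "\<dots> = emeasure lborel (S x \<inter> S y) + ennreal (4 * \<delta>)"
      using \<delta> by (simp add: ennreal_plus[symmetric] del: ennreal_plus)
    finally have "ennreal (5 * \<delta>) \<le> emeasure lborel (S x \<inter> S y) + ennreal (4 * \<delta>)" .
    moreover have "ennreal (5 * \<delta>) = ennreal \<delta> + ennreal (4 * \<delta>)"
      using \<delta> by (simp add: ennreal_plus[symmetric] del: ennreal_plus)
    ultimately have "ennreal \<delta> \<le> emeasure lborel (S x \<inter> S y)"
      by (simp add: ennreal_add_left_cancel_le add.commute[of _ "ennreal (4 * \<delta>)"])
    then have mass: "ennreal (k * \<delta>) \<le> emeasure \<mu> UNIV"
      using k by (simp add: em ennreal_mult' mult_left_mono)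
    have "emeasure \<mu> A \<le> emeasure (K u) A" if "A \<in> sets borel" "u = x \<or> u = y" for A u
    proof -
      have "emeasure \<mu> A \<le> ennreal k * emeasure lborel (A \<inter> S u)"
        unfolding em[OF that(1)] using that by (intro mult_left_mono emeasure_mono) auto
      also have "\<dots> \<le> emeasure (K u) A" using that xy by (intro lower) auto
      finally show ?thesis .
    qed
    then show "\<exists>\<mu>. sets \<mu> = sets borel \<and> ennreal (k * \<delta>) \<le> emeasure \<mu> UNIV \<and>
        (\<forall>A\<in>sets borel. emeasure \<mu> A \<le> emeasure (K x) A \<and> emeasure \<mu> A \<le> emeasure (K y) A)"
      using mass by (intro exI[of _ \<mu>]) (auto simp: \<mu>_def)
  qed
qed

lemma drift:
  assumes fin: "(\<integral>\<^sup>+x. ennreal \<bar>x\<bar> \<partial>scale_measure (ennreal (1 / a)) \<alpha>) < \<infinity>"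
  obtains g D where "0 \<le> g" "g < 1" "0 \<le> D"
    "\<And>x. (\<integral>\<^sup>+y. ennreal \<bar>y\<bar> \<partial>K x) \<le> ennreal (g * \<bar>x\<bar> + D)"
proof -
  interpret T: prob_space T by (rule prob_space_T)
  have V_fin: "(\<integral>\<^sup>+v. ennreal \<bar>v\<bar> \<partial>law_V) < \<infinity>"
    by (rule le_less_trans[OF nn_integral_law_V_le]) (use fin in \<open>simp add: ennreal_mult_less_top of_nat_less_top\<close>)
  define D where "D = enn2real (\<integral>\<^sup>+v. ennreal \<bar>v\<bar> \<partial>law_V)"
  define g where "g = (\<integral>\<omega>. 1 - \<theta> 1 \<omega> \<partial>M)"
  note [measurable] = measurable_\<theta>[OF order_refl] measurable_V[OF order_refl]
  have int: "integrable M (\<lambda>\<omega>. 1 - \<theta> 1 \<omega>)"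
  proof (rule integrable_const_bound[where B=1])
    show "AE \<omega> in M. norm (1 - \<theta> 1 \<omega>) \<le> 1"
      using AE_\<theta>[OF order_refl] by eventually_elim auto
  qed measurable
  have g1: "g < 1"
    unfolding g_def
  proof (rule expectation_less[OF int])
    show "AE \<omega> in M. 1 - \<theta> 1 \<omega> < 1"
      using AE_\<theta>[OF order_refl] by eventually_elim auto
  qed
  have pos: "AE \<omega> in M. 0 \<le> 1 - \<theta> 1 \<omega>"
    using AE_\<theta>[OF order_refl] by eventually_elim auto
  have g0: "0 \<le> g"
    unfolding g_def by (rule integral_nonneg_AE[OF pos])
  have D: "(\<integral>\<^sup>+\<omega>. ennreal \<bar>V 1 \<omega>\<bar> \<partial>M) = ennreal D"
  proof -
    have "(\<integral>\<^sup>+\<omega>. ennreal \<bar>V 1 \<omega>\<bar> \<partial>M) = (\<integral>\<^sup>+v. ennreal \<bar>v\<bar> \<partial>law_V)"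
      unfolding distr_V[OF order_refl, symmetric] by (subst nn_integral_distr) auto
    then show ?thesis using V_fin by (simp add: D_def)
  qed
  have le: "(\<integral>\<^sup>+y. ennreal \<bar>y\<bar> \<partial>K x) \<le> ennreal (g * \<bar>x\<bar> + D)" for x
  proof -
    have "(\<integral>\<^sup>+y. ennreal \<bar>y\<bar> \<partial>K x) = (\<integral>\<^sup>+\<omega>. ennreal \<bar>\<theta> 1 \<omega> * V 1 \<omega> + (1 - \<theta> 1 \<omega>) * x\<bar> \<partial>M)"
      unfolding K_eq_distr by (rule nn_integral_distr) measurable
    also have "\<dots> \<le> (\<integral>\<^sup>+\<omega>. ennreal \<bar>x\<bar> * ennreal (1 - \<theta> 1 \<omega>) + ennreal \<bar>V 1 \<omega>\<bar> \<partial>M)"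
    proof (rule nn_integral_mono_AE)
      show "AE \<omega> in M. ennreal \<bar>\<theta> 1 \<omega> * V 1 \<omega> + (1 - \<theta> 1 \<omega>) * x\<bar>
          \<le> ennreal \<bar>x\<bar> * ennreal (1 - \<theta> 1 \<omega>) + ennreal \<bar>V 1 \<omega>\<bar>"
        using AE_\<theta>[OF order_refl]
      proof eventually_elim
        case (elim \<omega>)
        have "\<bar>\<theta> 1 \<omega> * V 1 \<omega> + (1 - \<theta> 1 \<omega>) * x\<bar> \<le> \<bar>\<theta> 1 \<omega> * V 1 \<omega>\<bar> + \<bar>(1 - \<theta> 1 \<omega>) * x\<bar>"
          by (rule abs_triangle_ineq)
        also have "\<dots> \<le> \<bar>x\<bar> * (1 - \<theta> 1 \<omega>) + \<bar>V 1 \<omega>\<bar>"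
          using elim by (simp add: abs_mult mult_left_le_one_le)
        finally show ?case
          using elim by (simp add: ennreal_mult[symmetric] ennreal_plus[symmetric] ennreal_leI del: ennreal_plus)
      qed
    qed
    also have "\<dots> = ennreal \<bar>x\<bar> * (\<integral>\<^sup>+\<omega>. ennreal (1 - \<theta> 1 \<omega>) \<partial>M) + ennreal D"
      by (simp add: nn_integral_add nn_integral_cmult D)
    also have "(\<integral>\<^sup>+\<omega>. ennreal (1 - \<theta> 1 \<omega>) \<partial>M) = ennreal g"
      unfolding g_def by (rule nn_integral_eq_integral[OF int pos])
    also have "ennreal \<bar>x\<bar> * ennreal g + ennreal D = ennreal (g * \<bar>x\<bar> + D)"
      using g0 by (simp add: D_def ennreal_mult[symmetric] ennreal_plus[symmetric] mult.commute del: ennreal_plus)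
    finally show ?thesis .
  qed
  show ?thesis by (rule that[OF g0 g1 _ le]) (simp add: D_def)
qed

lemma geometric_convergence:
  assumes fin: "(\<integral>\<^sup>+x. ennreal \<bar>x\<bar> \<partial>scale_measure (ennreal (1 / a)) \<alpha>) < \<infinity>"
    and nd: "\<not> point_supported \<alpha>"
  obtains \<pi> \<rho> C where "invariant_distribution borel K \<pi>" "0 < \<rho>" "\<rho> < 1"
    "\<And>x m A. A \<in> sets borel \<Longrightarrow> \<bar>measure (kernel_pow borel K m x) A - measure \<pi> A\<bar> \<le> C * (1 + \<bar>x\<bar>) * \<rho> ^ m"
proof -
  obtain g D where gD: "0 \<le> g" "g < 1" "0 \<le> D"
    "\<And>x. (\<integral>\<^sup>+y. ennreal \<bar>y\<bar> \<partial>K x) \<le> ennreal (g * \<bar>x\<bar> + D)"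
    using drift[OF fin] by blast
  interpret H: harris_kernel borel K abs g D
    by unfold_locales (use gD minorization[OF nd] in auto)
  have "space (borel :: real measure) \<noteq> {}" by simp
  from H.harris[OF this] obtain \<pi> \<rho> C where "invariant_distribution borel K \<pi>" "0 < \<rho>" "\<rho> < 1"
    "\<forall>x\<in>space borel. \<forall>m. \<forall>A\<in>sets borel. \<bar>measure (kernel_pow borel K m x) A - measure \<pi> A\<bar> \<le> C * (1 + \<bar>x\<bar>) * \<rho> ^ m"
    by (elim exE conjE)
  then show ?thesis by (intro that[of \<pi> \<rho> C]) auto
qed

end

section \<open>Ergodicity\<close>

lemma tv_dist_le:
  "(\<And>A. A \<in> sets \<mu> \<Longrightarrow> \<bar>measure \<mu> A - measure \<nu> A\<bar> \<le> e) \<Longrightarrow> tv_dist \<mu> \<nu> \<le> e"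
  unfolding tv_dist_def by (intro cSUP_least) auto

lemma tv_dist_nonneg:
  assumes "\<And>A. A \<in> sets \<mu> \<Longrightarrow> \<bar>measure \<mu> A - measure \<nu> A\<bar> \<le> e"
  shows "0 \<le> tv_dist \<mu> \<nu>"
  unfolding tv_dist_def using assms by (intro cSUP_upper2[of _ _ "{}"] bdd_aboveI2) auto

lemma prob_space_eq_return:
  assumes \<mu>: "prob_space \<mu>" "sets \<mu> = sets S" and c: "{c} \<in> sets S" "measure \<mu> {c} = 1"
  shows "\<mu> = return S c"
proof (rule measure_eqI)
  interpret prob_space \<mu> by fact
  fix A assume "A \<in> sets \<mu>"
  then have A: "A \<in> sets S" using \<mu>(2) by simp
  have "AE x in \<mu>. x \<in> {c}"
    using prob_eq_1[of "{c}"] c \<mu>(2) by simp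
  then have "emeasure \<mu> A = emeasure \<mu> (if c \<in> A then space \<mu> else {})"
    using A \<mu>(2) by (intro emeasure_eq_AE) auto
  also have "\<dots> = emeasure (return S c) A"
    using A emeasure_space_1 by (simp add: indicator_def)
  finally show "emeasure \<mu> A = emeasure (return S c) A" .
qed (simp add: \<mu>)

context markov_kernel
begin

lemma absorbing_kernel_pow:
  assumes E: "absorbing S K E" and x: "x \<in> E"
  shows "measure (kernel_pow S K m x) E = 1"
  using x
proof (induction m arbitrary: x)
  case 0
  then show ?case using E by (simp add: absorbing_def measure_return)
next
  case (Suc m)
  have E': "E \<in> sets S" using E by (simp add: absorbing_def)
  have xS: "x \<in> space S" using sets.sets_into_space[OF E'] Suc.prems by blast
  interpret K: prob_space "K x" by (rule prob_space_K[OF xS])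
  have "measure (K x) E = 1" using E Suc.prems by (simp add: absorbing_def)
  then have "AE y in K x. y \<in> E" using K.prob_eq_1[of E] E' sets_K[OF xS] by simp
  then have "(\<integral>y. measure (kernel_pow S K m y) E \<partial>K x) = (\<integral>y. 1 \<partial>K x)"
  proof (intro integral_cong_AE)
    show "AE y in K x. measure (kernel_pow S K m y) E = 1"
      using \<open>AE y in K x. y \<in> E\<close> by eventually_elim (rule Suc.IH)
    have "(\<lambda>y. measure (kernel_pow S K m y) E) \<in> borel_measurable S" using E' by measurable
    then show "(\<lambda>y. measure (kernel_pow S K m y) E) \<in> borel_measurable (K x)"
      using measurable_cong_sets[OF sets_K[OF xS] refl] by blast
  qed simp
  then show ?case unfolding measure_kernel_pow_Suc(1)[OF xS E'] by (simp add: K.prob_space)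
qed

lemma absorbing_singleton_kernel_pow:
  assumes "absorbing S K {c}"
  shows "kernel_pow S K m c = return S c"
proof -
  have c: "{c} \<in> sets S" using assms by (simp add: absorbing_def)
  then have "c \<in> space S" using sets.sets_into_space by blast
  then show ?thesis
    using absorbing_kernel_pow[OF assms, of c m] prob_space_kernel_pow sets_kernel_pow c
    by (intro prob_space_eq_return) auto
qed

lemma ergodic_on_absorbing_singleton:
  assumes "absorbing S K {c}"
  shows "geometrically_ergodic_on {c} S K" and "uniformly_ergodic_on {c} S K"
proof -
  have c: "{c} \<in> sets S" using assms by (simp add: absorbing_def)
  then have cS: "c \<in> space S" using sets.sets_into_space by blast
  have "K c = return S c"
    using assms c cS prob_space_K sets_K by (intro prob_space_eq_return) (auto simp: absorbing_def)
  then have inv: "invariant_distribution S K (return S c)"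
    unfolding invariant_distribution_def
    using bind_return[OF measurable_prob_algebraD[OF K] cS] cS by (simp add: prob_space_return)
  have m: "measure (return S c) {c} = 1" using c by (simp add: measure_return)
  have tv: "tv_dist (kernel_pow S K m c) (return S c) = 0" for m
    unfolding absorbing_singleton_kernel_pow[OF assms]
    by (rule antisym[OF tv_dist_le tv_dist_nonneg[where e=0]]) auto
  show "geometrically_ergodic_on {c} S K"
    unfolding geometrically_ergodic_on_def using assms inv m tv
    by (intro conjI exI[of _ "return S c"] exI[of _ "1 / 2 :: real"] exI[of _ "\<lambda>_. 0 :: real"]) auto
  show "uniformly_ergodic_on {c} S K"
    unfolding uniformly_ergodic_on_def using assms inv m tv
    by (intro conjI exI[of _ "return S c"] uniform_limitI) auto
qed

end

context polya_mean_chain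
begin

lemma ergodic_on_absorbing:
  assumes fin: "(\<integral>\<^sup>+x. ennreal \<bar>x\<bar> \<partial>scale_measure (ennreal (1 / a)) \<alpha>) < \<infinity>"
    and nd: "\<not> point_supported \<alpha>"
    and E: "absorbing borel K E" "E \<noteq> {}"
  shows "geometrically_ergodic_on E borel K"
    and "bounded E \<Longrightarrow> uniformly_ergodic_on E borel K"
proof -
  obtain \<pi> \<rho> C where \<pi>: "invariant_distribution borel K \<pi>" and \<rho>: "0 < \<rho>" "\<rho> < 1" and
    conv: "\<And>x m A. A \<in> sets borel \<Longrightarrow>
      \<bar>measure (kernel_pow borel K m x) A - measure \<pi> A\<bar> \<le> C * (1 + \<bar>x\<bar>) * \<rho> ^ m"
    using geometric_convergence[OF fin nd] by blast
  have conv': "\<bar>measure (kernel_pow borel K m x) A - measure \<pi> A\<bar> \<le> C * (1 + \<bar>x\<bar>) * \<rho> ^ m"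
    if "A \<in> sets (kernel_pow borel K m x)" for x m A
    using that K.sets_kernel_pow[of x m] by (intro conv) simp
  have tv: "tv_dist (kernel_pow borel K m x) \<pi> \<le> C * (1 + \<bar>x\<bar>) * \<rho> ^ m" for x m
    by (rule tv_dist_le) (rule conv')
  have tv0: "0 \<le> tv_dist (kernel_pow borel K m x) \<pi>" for x m
    by (rule tv_dist_nonneg) (rule conv')
  have z: "(\<lambda>m. c * \<rho> ^ m) \<longlonglongrightarrow> 0" for c
    using tendsto_mult[OF tendsto_const LIMSEQ_realpow_zero, of \<rho> c] \<rho> by simp
  have \<pi>E: "measure \<pi> E = 1"
  proof -
    obtain x where x: "x \<in> E" using E(2) by blast
    have E': "E \<in> sets borel" using E(1) by (simp add: absorbing_def)
    have "\<bar>1 - measure \<pi> E\<bar> \<le> 0"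
      by (rule LIMSEQ_le_const[OF z])
        (use conv[OF E', of _ x] K.absorbing_kernel_pow[OF E(1) x] in auto)
    then show ?thesis by simp
  qed
  show "geometrically_ergodic_on E borel K"
    unfolding geometrically_ergodic_on_def using E(1) \<pi> \<pi>E \<rho> tv
    by (intro conjI exI[of _ \<pi>] exI[of _ \<rho>] exI[of _ "\<lambda>x. C * (1 + \<bar>x\<bar>)"]) auto
  show "uniformly_ergodic_on E borel K" if bE: "bounded E"
    unfolding uniformly_ergodic_on_def
  proof (intro conjI exI[of _ \<pi>] E(1) \<pi> \<pi>E uniform_limitI)
    obtain r where r: "\<And>x. x \<in> E \<Longrightarrow> \<bar>x\<bar> \<le> r"
      using bE unfolding bounded_iff by auto
    fix e :: real assume "0 < e"
    with order_tendstoD(2)[OF z, of e "\<bar>C\<bar> * (1 + r)"]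
    have "\<forall>\<^sub>F m in sequentially. \<bar>C\<bar> * (1 + r) * \<rho> ^ m < e" by simp
    then show "\<forall>\<^sub>F m in sequentially. \<forall>x\<in>E. dist (tv_dist (kernel_pow borel K m x) \<pi>) 0 < e"
    proof eventually_elim
      case (elim m)
      show ?case
      proof
        fix x assume x: "x \<in> E"
        have "tv_dist (kernel_pow borel K m x) \<pi> \<le> C * (1 + \<bar>x\<bar>) * \<rho> ^ m" by (rule tv)
        also have "\<dots> \<le> \<bar>C\<bar> * (1 + r) * \<rho> ^ m"
          using r[OF x] \<rho> by (intro mult_right_mono mult_mono) auto
        also have "\<dots> < e" by (rule elim)
        finally show "dist (tv_dist (kernel_pow borel K m x) \<pi>) 0 < e"
          using tv0 by (simp add: dist_real_def)
      qed
    qed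
  qed
qed

lemma msupport_point:
  assumes c: "AE x in \<alpha>. x = c"
  shows "msupport \<alpha> = {c}"
proof -
  interpret \<alpha>: finite_measure \<alpha> by (rule finite_\<alpha>)
  have em: "emeasure \<alpha> U = (if c \<in> U then emeasure \<alpha> UNIV else 0)" if "open U" for U
  proof -
    have "emeasure \<alpha> U = emeasure \<alpha> (if c \<in> U then UNIV else {})"
      using c that sets_\<alpha> by (intro emeasure_eq_AE) auto
    then show ?thesis by simp
  qed
  have pos: "0 < emeasure \<alpha> UNIV" using a by (simp add: \<alpha>.emeasure_eq_measure)
  have "c \<in> msupport \<alpha>"
    unfolding msupport_def
  proof (intro CollectI allI impI)
    fix U assume "open U" "c \<in> U"
    then show "0 < emeasure \<alpha> U" using pos unfolding em[OF \<open>open U\<close>] by simp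
  qed
  moreover have "x \<notin> msupport \<alpha>" if "x \<noteq> c" for x
  proof -
    have "open (- {c})" "x \<in> - {c}" using that by auto
    moreover have "emeasure \<alpha> (- {c}) = 0" by (subst em) auto
    ultimately show ?thesis unfolding msupport_def by fastforce
  qed
  ultimately show ?thesis by blast
qed

lemma AE_hull_msupport: "AE x in \<alpha>. x \<in> convex hull (msupport \<alpha>)"
  using AE_msupport[OF sets_\<alpha>] by eventually_elim (rule hull_inc)

lemma hull_ergodic_if_point_supported:
  assumes "point_supported \<alpha>"
  shows "geometrically_ergodic_on (convex hull (msupport \<alpha>)) borel K"
    and "uniformly_ergodic_on (convex hull (msupport \<alpha>)) borel K"
proof -
  obtain c where "AE x in \<alpha>. x = c" using assms by (auto simp: point_supported_def)
  then have h: "convex hull (msupport \<alpha>) = {c}" by (simp add: msupport_point)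
  have "absorbing borel K {c}"
    using absorbing_convex[OF convex_convex_hull AE_hull_msupport] unfolding h .
  then show "geometrically_ergodic_on (convex hull (msupport \<alpha>)) borel K"
    and "uniformly_ergodic_on (convex hull (msupport \<alpha>)) borel K"
    unfolding h by (rule K.ergodic_on_absorbing_singleton)+
qed

lemma bounded_msupport_finite_mean:
  assumes "bounded (msupport \<alpha>)"
  shows "(\<integral>\<^sup>+x. ennreal \<bar>x\<bar> \<partial>scale_measure (ennreal (1 / a)) \<alpha>) < \<infinity>"
proof -
  interpret \<alpha>: finite_measure \<alpha> by (rule finite_\<alpha>)
  obtain r where r: "\<And>x. x \<in> msupport \<alpha> \<Longrightarrow> \<bar>x\<bar> \<le> r"
    using assms unfolding bounded_iff by auto
  have "(\<integral>\<^sup>+x. ennreal \<bar>x\<bar> \<partial>\<alpha>) \<le> (\<integral>\<^sup>+x. ennreal r \<partial>\<alpha>)"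
    by (rule nn_integral_mono_AE) (use AE_msupport[OF sets_\<alpha>] in \<open>eventually_elim, auto intro!: ennreal_leI r\<close>)
  also have "\<dots> < \<infinity>" by (simp add: ennreal_mult_less_top \<alpha>.emeasure_eq_measure)
  finally have "(\<integral>\<^sup>+x. ennreal \<bar>x\<bar> \<partial>\<alpha>) < \<infinity>" .
  moreover have "(\<lambda>x. ennreal \<bar>x\<bar>) \<in> borel_measurable \<alpha>"
    unfolding measurable_cong_sets[OF sets_\<alpha> refl] by measurable
  ultimately show ?thesis
    by (simp add: nn_integral_scale_measure ennreal_mult_less_top)
qed

end

theorem theorem5:
  fixes \<alpha> \<alpha>0 :: "real measure" and a :: real and n :: nat
    and M :: "'w measure" and \<theta> :: "nat \<Rightarrow> 'w \<Rightarrow> real" and q Y :: "nat \<Rightarrow> nat \<Rightarrow> 'w \<Rightarrow> real"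
    and N :: "'p measure" and Z :: "nat \<Rightarrow> 'p \<Rightarrow> real"
    and K :: "real \<Rightarrow> real measure"
  assumes alpha: "finite_measure \<alpha>" "sets \<alpha> = sets borel"
    and a: "a = measure \<alpha> UNIV" "a > 0"
    and alpha0: "\<alpha>0 = scale_measure (ennreal (1 / a)) \<alpha>"
    and n: "n \<ge> 1"
    and M: "prob_space M"
    and theta: "prob_space.indep_vars M (\<lambda>_. borel) \<theta> {1..}"
      "\<And>m. m \<ge> 1 \<Longrightarrow> distributed M lborel (\<theta> m) (\<lambda>x. ennreal (beta_density (real n) a x))"
    and q: "prob_space.indep_vars M (\<lambda>_. PiM {1..n} (\<lambda>_. borel)) (\<lambda>m. rvec {1..n} (q m)) {1..}"
      "\<And>m. m \<ge> 1 \<Longrightarrow>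
         distr M (PiM {1..n} (\<lambda>_. borel)) (rvec {1..n} (q m)) = dirichlet {1..n} (\<lambda>_. 1)"
    and polya: "polya_sequence \<alpha> N Z"
    and Y: "prob_space.indep_vars M (\<lambda>_. PiM {1..n} (\<lambda>_. borel)) (\<lambda>m. rvec {1..n} (Y m)) {1..}"
      "\<And>m. m \<ge> 1 \<Longrightarrow>
         distr M (PiM {1..n} (\<lambda>_. borel)) (rvec {1..n} (Y m)) =
         distr N (PiM {1..n} (\<lambda>_. borel)) (rvec {1..n} Z)"
    and indep: "indep_three M
        (PiM {1..} (\<lambda>_. borel)) (rvec {1..} \<theta>)
        (PiM {1..} (\<lambda>_. PiM {1..n} (\<lambda>_. borel))) (rvec {1..} (\<lambda>m. rvec {1..n} (q m)))
        (PiM {1..} (\<lambda>_. PiM {1..n} (\<lambda>_. borel))) (rvec {1..} (\<lambda>m. rvec {1..n} (Y m)))"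
    and K: "K = mean_kernel M n \<theta> q Y"
  shows "((\<forall>x. markov_chain M borel K (mean_chain n \<theta> q Y x)) \<and> stochastically_monotone K) \<and>
    (\<integral>\<^sup>+\<omega>. ennreal \<bar>Y 1 1 \<omega>\<bar> \<partial>M) = (\<integral>\<^sup>+x. ennreal \<bar>x\<bar> \<partial>\<alpha>0) \<and>
    ((\<integral>\<^sup>+x. ennreal \<bar>x\<bar> \<partial>\<alpha>0) < \<infinity> \<longrightarrow>
       geometrically_ergodic_on (convex hull (msupport \<alpha>)) borel K \<and>
       (\<not> point_supported \<alpha> \<longrightarrow> geometrically_ergodic_on UNIV borel K)) \<and>
    (bounded (msupport \<alpha>) \<longrightarrow>
       uniformly_ergodic_on (convex hull (msupport \<alpha>)) borel K \<and>
       (\<not> point_supported \<alpha> \<longrightarrow>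
          (\<forall>u v. msupport \<alpha> \<subseteq> {u..v} \<longrightarrow> uniformly_ergodic_on {u..v} borel K)))"
proof -
  let ?P = "distr N (PiM {1..n} (\<lambda>_. borel)) (rvec {1..n} Z)"
  let ?T = "density lborel (\<lambda>x. ennreal (beta_density (real n) a x))"
  interpret M: prob_space M by fact
  interpret C: polya_mean_chain M n \<theta> q Y ?T "dirichlet {1..n} (\<lambda>_. 1)" ?P \<alpha> a N Z
  proof (intro polya_mean_chain.intro mean_chain_model.intro mean_chain_model_axioms.intro
      polya_model.intro polya_mean_chain_axioms.intro)
    have e: "(\<lambda>t. \<lambda>i\<in>{1..n}. t) \<in> borel \<rightarrow>\<^sub>M PiM {1..n} (\<lambda>_. borel :: real measure)"
      by (intro measurable_restrict) simp
    show "M.indep_vars (\<lambda>_. PiM {1..n} (\<lambda>_. borel))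
      (\<lambda>(k, m) \<omega>. [\<lambda>i\<in>{1..n}. \<theta> m \<omega>, rvec {1..n} (q m) \<omega>, rvec {1..n} (Y m) \<omega>] ! k) ({..<3} \<times> {1..})"
      using M.indep_vars_three_families[OF theta(1) q(1) Y(1) indep e measurable_ident measurable_ident]
      by simp
    show "distr M borel (\<theta> m) = ?T" if "1 \<le> m" for m
    proof -
      have "distr M borel (\<theta> m) = distr M lborel (\<theta> m)" by (rule distr_cong) auto
      then show ?thesis using distributed_distr_eq_density[OF theta(2)[OF that]] by simp
    qed
  qed (rule refl | fact M n alpha a polya q(2) Y(2))+
  have K_eq: "K = C.K" unfolding K by (rule C.mean_kernel_eq)
  have hull: "absorbing borel C.K (convex hull (msupport \<alpha>))"
    by (rule C.absorbing_convex[OF convex_convex_hull C.AE_hull_msupport])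
  have univ: "absorbing borel C.K UNIV"
    by (rule C.absorbing_convex) auto
  have ne: "convex hull (msupport \<alpha>) \<noteq> {}" if "\<not> point_supported \<alpha>"
    using C.msupport_two_points[OF that] by (metis convex_hull_eq_empty empty_iff)
  have interval: "absorbing borel C.K {u..v}" if "msupport \<alpha> \<subseteq> {u..v}" for u v
  proof (rule C.absorbing_convex)
    show "AE x in \<alpha>. x \<in> {u..v}"
      using AE_msupport[OF alpha(2)] by eventually_elim (use that in blast)
  qed simp
  have fin: "(\<integral>\<^sup>+x. ennreal \<bar>x\<bar> \<partial>\<alpha>0) < \<infinity>" if "bounded (msupport \<alpha>)"
    unfolding alpha0 by (rule C.bounded_msupport_finite_mean[OF that])
  have i: "(\<forall>x. markov_chain M borel K (mean_chain n \<theta> q Y x)) \<and> stochastically_monotone K"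
    unfolding K_eq using C.markov_chain_mean_chain C.stochastically_monotone_K by blast
  have mean: "(\<integral>\<^sup>+\<omega>. ennreal \<bar>Y 1 1 \<omega>\<bar> \<partial>M) = (\<integral>\<^sup>+x. ennreal \<bar>x\<bar> \<partial>\<alpha>0)"
    unfolding alpha0 by (rule C.nn_integral_Y) (use n in auto)
  have ii: "geometrically_ergodic_on (convex hull (msupport \<alpha>)) borel K \<and>
      (\<not> point_supported \<alpha> \<longrightarrow> geometrically_ergodic_on UNIV borel K)"
    if "(\<integral>\<^sup>+x. ennreal \<bar>x\<bar> \<partial>\<alpha>0) < \<infinity>"
  proof (cases "point_supported \<alpha>")
    case True
    then show ?thesis unfolding K_eq using C.hull_ergodic_if_point_supported(1) by simp
  next
    case False
    note erg = C.ergodic_on_absorbing(1)[OF that[unfolded alpha0] False]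
    show ?thesis
      unfolding K_eq using erg[OF hull ne[OF False]] erg[OF univ UNIV_not_empty] by blast
  qed
  have iii: "uniformly_ergodic_on (convex hull (msupport \<alpha>)) borel K \<and>
      (\<not> point_supported \<alpha> \<longrightarrow>
        (\<forall>u v. msupport \<alpha> \<subseteq> {u..v} \<longrightarrow> uniformly_ergodic_on {u..v} borel K))"
    if bd: "bounded (msupport \<alpha>)"
  proof (cases "point_supported \<alpha>")
    case True
    then show ?thesis unfolding K_eq using C.hull_ergodic_if_point_supported(2) by simp
  next
    case False
    note erg = C.ergodic_on_absorbing(2)[OF fin[OF bd, unfolded alpha0] False]
    have "uniformly_ergodic_on {u..v} borel C.K" if "msupport \<alpha> \<subseteq> {u..v}" for u v
    proof (rule erg[OF interval[OF that]])
      show "{u..v} \<noteq> {}" using ne[OF False] that by auto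
    qed simp
    then show ?thesis
      unfolding K_eq using erg[OF hull ne[OF False] bounded_convex_hull[OF bd]] by blast
  qed
  show ?thesis
    by (rule conjI[OF i conjI[OF mean conjI[OF impI[OF ii] impI[OF iii]]]])
qed

end
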